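(* Let $n,l$ be integers with $2\le l\le n-2$, let $k$ be a field, let $\Delta$ be an $l\times n$ matrix over $S=k[X_1,\dots,X_n,A]$ satisfying conditions (1), (2), (3) of the context, and let $R=S/J$ and $a\in R$ be the graded ring and the element constructed from $\Delta$ in the context. Then $a$ is a homogeneous parameter of $R$ satisfying $(0):_R((0):_R a)=(a)$, namely, $\mathrm{Ext}_R^1(R/(a),R)=(0)$.
   Context: $S=k[X_1,\dots,X_n,A]$ is a polynomial ring over the field $k$, $\mathbb Z$-graded with $S_0=k$ and $\deg X_i=\deg A=1$ for $1\le i\le n$. Put $V=\sum_{j=l+1}^n kX_j\subseteq S_1$. The matrix $\Delta=(\Delta_{i,j})_{1\le i\le l,\,1\le j\le n}$ over $S$ is assumed to satisfy: (1) the submatrix $(\Delta_{i,j})_{1\le i,j\le l}$ is symmetric; (2) $V=\sum_{1\le i\le l,\,1\le j\le n}k\Delta_{i,j}$; (3) if $c_1,\dots,c_n\in k$ satisfy $\Delta\,(c_1,\dots,c_n)^{T}=0$, then $c_1=\cdots=c_n=0$. Define the homogeneous ideal $$J=(AX_1,\dots,AX_l)+(X_{l+1},\dots,X_n)^2+(X_iX_j-A\Delta_{i,j})_{1\le i\le l,\,1\le j\le n}$$ of $S$, and set $R=S/J$. Let $a$ be the residue class of $A$ in $R$. The ring $R$ has dimension $1$; a homogeneous parameter of $R$ is a homogeneous element $a$ of positive degree such that $R/(a)$ is Artinian. *)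

theory Defs
  imports "HOL-Algebra.Algebra" "HOL-Library.Poly_Mapping" "HOL-Library.FuncSet"
begin

section \<open>The polynomial ring $S = k[X_1,\dots,X_n,A]$\<close>

text \<open>
  A monomial is an exponent vector of type \<open>nat \<Rightarrow>\<^sub>0 nat\<close>, and the product of the type class
  instance for \<open>\<Rightarrow>\<^sub>0\<close> is the convolution, i.e. the product of polynomials. Indeterminate
  number \<open>j\<close> is $X_j$ for $1 \le j \le n$, and indeterminate number \<open>0\<close> is $A$. The type has
  infinitely many indeterminates; $S$ is cut out by the carrier of \<open>S_ring n\<close>.
\<close>

type_synonym 'k mpoly = "(nat \<Rightarrow>\<^sub>0 nat) \<Rightarrow>\<^sub>0 'k"

definition Xvar :: "nat \<Rightarrow> 'k::field mpoly" where
  "Xvar j = Poly_Mapping.single (Poly_Mapping.single j 1) 1"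

definition Avar :: "'k::field mpoly" where
  "Avar = Xvar 0"

definition const :: "'k \<Rightarrow> 'k::field mpoly" where
  "const c = Poly_Mapping.single 0 c"

definition S_ring :: "nat \<Rightarrow> 'k::field mpoly ring" where
  "S_ring n = \<lparr>carrier = {p. \<forall>m \<in> Poly_Mapping.keys p. Poly_Mapping.keys m \<subseteq> {0..n}},
               monoid.mult = (*), one = 1, ring.zero = 0, add = (+)\<rparr>"

definition monom_degree :: "(nat \<Rightarrow>\<^sub>0 nat) \<Rightarrow> nat" where
  "monom_degree m = (\<Sum>j \<in> Poly_Mapping.keys m. Poly_Mapping.lookup m j)"

text \<open>The component $S_d$; the components of negative degree are zero and are not represented.\<close>

definition S_component :: "nat \<Rightarrow> nat \<Rightarrow> 'k::field mpoly set" where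
  "S_component n d = {p \<in> carrier (S_ring n). \<forall>m \<in> Poly_Mapping.keys p. monom_degree m = d}"

definition kscale :: "'k \<Rightarrow> 'k mpoly \<Rightarrow> 'k::field mpoly" where
  "kscale c p = const c * p"

global_interpretation kvs: vector_space kscale
  by unfold_locales
    (simp_all add: kscale_def const_def algebra_simps single_add mult_single
      flip: mult.assoc single_one)

lemma S_ring_simps [simp]:
  "p \<otimes>\<^bsub>S_ring n\<^esub> q = p * q" "\<one>\<^bsub>S_ring n\<^esub> = 1" "\<zero>\<^bsub>S_ring n\<^esub> = 0" "p \<oplus>\<^bsub>S_ring n\<^esub> q = p + q"
  by (simp_all add: S_ring_def)


section \<open>The ideal $J$, the ring $R = S/J$ and the element $a$\<close>

definition J_ideal :: "nat \<Rightarrow> nat \<Rightarrow> (nat \<Rightarrow> nat \<Rightarrow> 'k mpoly) \<Rightarrow> 'k::field mpoly set" where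
  "J_ideal n l \<Delta> =
     Idl\<^bsub>S_ring n\<^esub> {Avar * Xvar i | i. i \<in> {1..l}}
     <+>\<^bsub>S_ring n\<^esub> ideal_prod (S_ring n) (Idl\<^bsub>S_ring n\<^esub> (Xvar ` {l+1..n})) (Idl\<^bsub>S_ring n\<^esub> (Xvar ` {l+1..n}))
     <+>\<^bsub>S_ring n\<^esub> Idl\<^bsub>S_ring n\<^esub> {Xvar i * Xvar j - Avar * \<Delta> i j | i j. i \<in> {1..l} \<and> j \<in> {1..n}}"

definition R_ring :: "nat \<Rightarrow> nat \<Rightarrow> (nat \<Rightarrow> nat \<Rightarrow> 'k mpoly) \<Rightarrow> 'k::field mpoly set ring" where
  "R_ring n l \<Delta> = S_ring n Quot J_ideal n l \<Delta>"

definition residue :: "nat \<Rightarrow> nat \<Rightarrow> (nat \<Rightarrow> nat \<Rightarrow> 'k mpoly) \<Rightarrow> 'k mpoly \<Rightarrow> 'k::field mpoly set" where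
  "residue n l \<Delta> p = J_ideal n l \<Delta> +>\<^bsub>S_ring n\<^esub> p"

definition a_elem :: "nat \<Rightarrow> nat \<Rightarrow> (nat \<Rightarrow> nat \<Rightarrow> 'k mpoly) \<Rightarrow> 'k::field mpoly set" where
  "a_elem n l \<Delta> = residue n l \<Delta> Avar"

text \<open>The grading that $R$ inherits from $S$: $R_d$ is the image of $S_d$.\<close>

definition R_component ::
    "nat \<Rightarrow> nat \<Rightarrow> (nat \<Rightarrow> nat \<Rightarrow> 'k mpoly) \<Rightarrow> nat \<Rightarrow> 'k::field mpoly set set" where
  "R_component n l \<Delta> d = residue n l \<Delta> ` S_component n d"


section \<open>Artinian rings, homogeneous parameters, colon ideals\<close>

definition artinian_ring :: "('a, 'b) ring_scheme \<Rightarrow> bool" where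
  "artinian_ring R \<longleftrightarrow> ring R \<and>
     (\<forall>I :: nat \<Rightarrow> 'a set. (\<forall>i. ideal (I i) R) \<and> (\<forall>i. I (Suc i) \<subseteq> I i)
        \<longrightarrow> (\<exists>N. \<forall>i\<ge>N. I i = I N))"

text \<open>\<open>G d\<close> is the component of degree \<open>d\<close> of the nonnegatively graded ring \<open>R\<close>.\<close>

definition homogeneous_parameter ::
    "('a, 'b) ring_scheme \<Rightarrow> (nat \<Rightarrow> 'a set) \<Rightarrow> 'a \<Rightarrow> bool" where
  "homogeneous_parameter R G a \<longleftrightarrow> (\<exists>d>0. a \<in> G d) \<and> artinian_ring (R Quot (PIdl\<^bsub>R\<^esub> a))"

definition colon :: "('a, 'b) ring_scheme \<Rightarrow> 'a set \<Rightarrow> 'a set \<Rightarrow> 'a set" where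
  "colon R I T = {x \<in> carrier R. \<forall>y \<in> T. x \<otimes>\<^bsub>R\<^esub> y \<in> I}"


section \<open>Modules and $\mathrm{Ext}^1$\<close>

text \<open>
  The record type of modules extends that of rings; the \<open>mult\<close> and \<open>one\<close> fields play no role
  in the locale \<open>module\<close>.
\<close>

definition restrict_scalars :: "('a \<Rightarrow> 'm) \<Rightarrow> ('m, 'c) ring_scheme \<Rightarrow> ('a, 'm) module" where
  "restrict_scalars h T = \<lparr>carrier = carrier T, monoid.mult = monoid.mult T, one = one T,
     ring.zero = ring.zero T, add = add T, smult = (\<lambda>r x. h r \<otimes>\<^bsub>T\<^esub> x)\<rparr>"

definition regular_module :: "('a, 'b) ring_scheme \<Rightarrow> ('a, 'a) module" where
  "regular_module R = restrict_scalars (\<lambda>r. r) R"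

definition quotient_module :: "('a, 'b) ring_scheme \<Rightarrow> 'a set \<Rightarrow> ('a, 'a set) module" where
  "quotient_module R I = restrict_scalars (\<lambda>r. I +>\<^bsub>R\<^esub> r) (R Quot I)"

definition mod_hom ::
    "('a, 'b) ring_scheme \<Rightarrow> ('a, 'm, 'c) module_scheme \<Rightarrow> ('a, 'n, 'd) module_scheme \<Rightarrow> ('m \<Rightarrow> 'n) set" where
  "mod_hom R M N = {f \<in> carrier M \<rightarrow>\<^sub>E carrier N.
     (\<forall>x \<in> carrier M. \<forall>y \<in> carrier M. f (x \<oplus>\<^bsub>M\<^esub> y) = f x \<oplus>\<^bsub>N\<^esub> f y) \<and>
     (\<forall>r \<in> carrier R. \<forall>x \<in> carrier M. f (r \<odot>\<^bsub>M\<^esub> x) = r \<odot>\<^bsub>N\<^esub> f x)}"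

text \<open>The group $\mathrm{Hom}_R(M,N)$ under pointwise addition, written as a \<open>monoid\<close> record.\<close>

definition Hom_group ::
    "('a, 'b) ring_scheme \<Rightarrow> ('a, 'm, 'c) module_scheme \<Rightarrow> ('a, 'n, 'd) module_scheme \<Rightarrow> ('m \<Rightarrow> 'n) monoid" where
  "Hom_group R M N = \<lparr>carrier = mod_hom R M N,
     monoid.mult = (\<lambda>f g. \<lambda>x \<in> carrier M. f x \<oplus>\<^bsub>N\<^esub> g x),
     one = (\<lambda>x \<in> carrier M. \<zero>\<^bsub>N\<^esub>)\<rparr>"

text \<open>
  \<open>free_cover R M\<close> is the free \<open>R\<close>-module with basis (the underlying set of) \<open>M\<close>: finitely
  supported functions to \<open>R\<close>, extended by zero outside \<open>carrier M\<close>. \<open>cover_map R M\<close> is the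
  surjection onto \<open>M\<close> sending the basis element of \<open>x\<close> to \<open>x\<close>, and \<open>syzygy R M\<close> is its kernel.
\<close>

definition free_cover ::
    "('a, 'b) ring_scheme \<Rightarrow> ('a, 'm, 'c) module_scheme \<Rightarrow> ('a, 'm \<Rightarrow> 'a) module" where
  "free_cover R M = \<lparr>
     carrier = {f. (\<forall>x. f x \<in> carrier R) \<and> (\<forall>x. x \<notin> carrier M \<longrightarrow> f x = \<zero>\<^bsub>R\<^esub>) \<and>
                   finite {x. f x \<noteq> \<zero>\<^bsub>R\<^esub>}},
     monoid.mult = undefined, one = undefined,
     ring.zero = (\<lambda>x. \<zero>\<^bsub>R\<^esub>), add = (\<lambda>f g x. f x \<oplus>\<^bsub>R\<^esub> g x),
     smult = (\<lambda>r f x. r \<otimes>\<^bsub>R\<^esub> f x)\<rparr>"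

definition cover_map ::
    "('a, 'b) ring_scheme \<Rightarrow> ('a, 'm, 'c) module_scheme \<Rightarrow> ('m \<Rightarrow> 'a) \<Rightarrow> 'm" where
  "cover_map R M f = finsum M (\<lambda>x. f x \<odot>\<^bsub>M\<^esub> x) {x. f x \<noteq> \<zero>\<^bsub>R\<^esub>}"

definition syzygy ::
    "('a, 'b) ring_scheme \<Rightarrow> ('a, 'm, 'c) module_scheme \<Rightarrow> ('a, 'm \<Rightarrow> 'a) module" where
  "syzygy R M = (free_cover R M)
     \<lparr>carrier := {f \<in> carrier (free_cover R M). cover_map R M f = \<zero>\<^bsub>M\<^esub>}\<rparr>"

text \<open>
  Iterating the construction gives the beginning
  \[ F_2 \to F_1 \to F_0 \to M \to 0 \]
  of a free resolution of \<open>M\<close>, with $F_0$, $F_1$, $F_2$ the free covers of \<open>M\<close>, of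
  \<open>K = syzygy R M\<close> $\subseteq F_0$ and of \<open>syzygy R K\<close> $\subseteq F_1$; the differentials
  are the cover maps of \<open>K\<close> and of \<open>syzygy R K\<close>. Then $\mathrm{Ext}^1_R(M,N)$ is
  the cohomology of $\mathrm{Hom}_R(F_\bullet,N)$ at $\mathrm{Hom}_R(F_1,N)$, here as an
  abelian group.
\<close>

definition Ext1_cocycles ::
    "('a, 'b) ring_scheme \<Rightarrow> ('a, 'm, 'c) module_scheme \<Rightarrow> ('a, 'n, 'd) module_scheme
      \<Rightarrow> ((('m \<Rightarrow> 'a) \<Rightarrow> 'a) \<Rightarrow> 'n) set" where
  "Ext1_cocycles R M N =
     (let K = syzygy R M; L = syzygy R K; F1 = free_cover R K; F2 = free_cover R L
      in {\<phi> \<in> mod_hom R F1 N. compose (carrier F2) \<phi> (cover_map R L) = \<one>\<^bsub>Hom_group R F2 N\<^esub>})"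

definition Ext1_coboundaries ::
    "('a, 'b) ring_scheme \<Rightarrow> ('a, 'm, 'c) module_scheme \<Rightarrow> ('a, 'n, 'd) module_scheme
      \<Rightarrow> ((('m \<Rightarrow> 'a) \<Rightarrow> 'a) \<Rightarrow> 'n) set" where
  "Ext1_coboundaries R M N =
     (let K = syzygy R M; F0 = free_cover R M; F1 = free_cover R K
      in {compose (carrier F1) \<psi> (cover_map R K) | \<psi>. \<psi> \<in> mod_hom R F0 N})"

definition Ext1 ::
    "('a, 'b) ring_scheme \<Rightarrow> ('a, 'm, 'c) module_scheme \<Rightarrow> ('a, 'n, 'd) module_scheme
      \<Rightarrow> ((('m \<Rightarrow> 'a) \<Rightarrow> 'a) \<Rightarrow> 'n) set monoid" where
  "Ext1 R M N =
     (Hom_group R (free_cover R (syzygy R M)) N)\<lparr>carrier := Ext1_cocycles R M N\<rparr>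
       Mod Ext1_coboundaries R M N"

end

theory Submission
  imports Defs
begin

text \<open>
  The relations give $A^2 V = 0$ and $A V X_r = 0$ for all $r$, so $R$ has the $k$-basis $A^d$
  ($d \ge 0$), $X_1,\dots,X_n$ and $A X_m$ ($m > l$). That nothing else collapses is seen from the
  linear functionals reading off these coefficients: their common kernel is an ideal containing the
  generators of $J$. An element $f$ of $(0) : ((0) : a)$ kills $A X_n$, hence has no constant term, and
  kills $X_1,\dots,X_l$, hence its linear coefficients $c_j$ satisfy
  $\sum_j c_j \Delta_{i,j} = 0$ for all $i$ and vanish by condition (3); so $f \in (a)$. The quotient
  $R/(a)$ is spanned by $1, X_1,\dots,X_n$ over $k$. Finally, every homomorphism $(a) \to R$ sends $a$ into
  $(0) : ((0) : a) = (a)$ and therefore extends to $R$, which means $\mathrm{Ext}^1_R(R/(a),R) = 0$.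
\<close>

section \<open>$\mathrm{Ext}^1$ of a cyclic module\<close>

text \<open>Condition (2) enters through both spanning sets of V: the entries of Delta give A^2 V =
  0, the variables give V^2 = 0 and coordinates on V. Condition (1) is a consistency condition: for
  i, j <= l the monomial X_i X_j occurs in two generators of J, and a functional that reads the
  coefficient of A X_m off Delta can vanish on both only if Delta_ij and Delta_ji agree. On the Ext
  side the obstacle is that the definition resolves R/(a) by the free module on all elements of
  R/(a), not by R -> R/(a). Two explicit linear maps bridge the gap and replace a comparison theorem
  for resolutions: r -> r e from R into that free module, with e the basis element over 1, and a
  lift of the cover map from the free module back to R. The scalars of k act on the polynomial type
  only, so all linear algebra is done on representatives in S and transported to R and R/(a) along
  the residue maps.\<close>

definition linear_extension ::
    "('a, 'b) ring_scheme \<Rightarrow> ('a, 'n, 'c) module_scheme \<Rightarrow> ('m \<Rightarrow> 'n) \<Rightarrow> ('m \<Rightarrow> 'a) \<Rightarrow> 'n" where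
  "linear_extension R N u f = finsum N (\<lambda>x. f x \<odot>\<^bsub>N\<^esub> u x) {x. f x \<noteq> \<zero>\<^bsub>R\<^esub>}"

definition delta :: "('a, 'b) ring_scheme \<Rightarrow> 'm \<Rightarrow> 'm \<Rightarrow> 'a" where
  "delta R x = (\<lambda>y. if y = x then \<one>\<^bsub>R\<^esub> else \<zero>\<^bsub>R\<^esub>)"

text \<open>\<open>linear_extension R N u\<close> is the map given by the universal property of the
  free module. Treating the cover map as the case of the identity lets one set of lemmas serve both
  it and the lift \<open>\<theta>\<close> used later.\<close>

lemma cover_map_eq: "cover_map R M = linear_extension R M (\<lambda>x. x)"
  by (simp add: fun_eq_iff cover_map_def linear_extension_def)

section \<open>Free covers, syzygies and module homomorphisms\<close>

lemma free_cover_simps [simp]: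
  "\<zero>\<^bsub>free_cover R M\<^esub> = (\<lambda>x. \<zero>\<^bsub>R\<^esub>)"
  "f \<oplus>\<^bsub>free_cover R M\<^esub> g = (\<lambda>x. f x \<oplus>\<^bsub>R\<^esub> g x)"
  "r \<odot>\<^bsub>free_cover R M\<^esub> f = (\<lambda>x. r \<otimes>\<^bsub>R\<^esub> f x)"
  by (simp_all add: free_cover_def)

lemma free_cover_carrier:
  "f \<in> carrier (free_cover R M) \<longleftrightarrow>
     (\<forall>x. f x \<in> carrier R) \<and> (\<forall>x. x \<notin> carrier M \<longrightarrow> f x = \<zero>\<^bsub>R\<^esub>) \<and> finite {x. f x \<noteq> \<zero>\<^bsub>R\<^esub>}"
  by (simp add: free_cover_def)

lemma syzygy_simps [simp]:
  "\<zero>\<^bsub>syzygy R M\<^esub> = (\<lambda>x. \<zero>\<^bsub>R\<^esub>)"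
  "f \<oplus>\<^bsub>syzygy R M\<^esub> g = (\<lambda>x. f x \<oplus>\<^bsub>R\<^esub> g x)"
  "r \<odot>\<^bsub>syzygy R M\<^esub> f = (\<lambda>x. r \<otimes>\<^bsub>R\<^esub> f x)"
  by (simp_all add: syzygy_def)

lemma syzygy_carrier:
  "f \<in> carrier (syzygy R M) \<longleftrightarrow> f \<in> carrier (free_cover R M) \<and> cover_map R M f = \<zero>\<^bsub>M\<^esub>"
  by (simp add: syzygy_def)

lemma mod_hom_carrier: "\<lbrakk>f \<in> mod_hom R M N; x \<in> carrier M\<rbrakk> \<Longrightarrow> f x \<in> carrier N"
  and mod_hom_add: "\<lbrakk>f \<in> mod_hom R M N; x \<in> carrier M; y \<in> carrier M\<rbrakk>
      \<Longrightarrow> f (x \<oplus>\<^bsub>M\<^esub> y) = f x \<oplus>\<^bsub>N\<^esub> f y"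
  and mod_hom_smult: "\<lbrakk>f \<in> mod_hom R M N; r \<in> carrier R; x \<in> carrier M\<rbrakk>
      \<Longrightarrow> f (r \<odot>\<^bsub>M\<^esub> x) = r \<odot>\<^bsub>N\<^esub> f x"
  and mod_hom_ext: "f \<in> mod_hom R M N \<Longrightarrow> f \<in> extensional (carrier M)"
  by (auto simp: mod_hom_def PiE_def Pi_def)

lemma mod_homI:
  assumes "f \<in> extensional (carrier M)"
    and "\<And>x. x \<in> carrier M \<Longrightarrow> f x \<in> carrier N"
    and "\<And>x y. \<lbrakk>x \<in> carrier M; y \<in> carrier M\<rbrakk> \<Longrightarrow> f (x \<oplus>\<^bsub>M\<^esub> y) = f x \<oplus>\<^bsub>N\<^esub> f y"
    and "\<And>r x. \<lbrakk>r \<in> carrier R; x \<in> carrier M\<rbrakk> \<Longrightarrow> f (r \<odot>\<^bsub>M\<^esub> x) = r \<odot>\<^bsub>N\<^esub> f x"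
  shows "f \<in> mod_hom R M N"
  using assms by (auto simp: mod_hom_def PiE_def)

text \<open>\<open>Ext1\<close> is a factor group, so it vanishes once the coboundaries fill the
  whole group of cocycles; every coset is then \<open>carrier G\<close>.\<close>

lemma (in group) trivial_factor_self: "trivial_group (G Mod carrier G)"
proof -
  have "carrier G #> x = carrier G" if "x \<in> carrier G" for x
    by (rule coset_join2[OF that subgroup_self that])
  then have "carrier (G Mod carrier G) = (\<Union>x\<in>carrier G. {carrier G})"
    unfolding FactGroup_def RCOSETS_def by simp
  also have "\<dots> = {carrier G}" using one_closed by blast
  finally have "carrier (G Mod carrier G) = {carrier G}" .
  then show ?thesis
    using normal.factorgroup_is_group[OF normal_self] by (simp add: trivial_group_def FactGroup_def)
qed

context cring
begin

lemma free_cover_module: "module R (free_cover R M)"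
proof (rule moduleI)
  have add: "(\<lambda>x. f x \<oplus> g x) \<in> carrier (free_cover R M)"
    if f: "f \<in> carrier (free_cover R M)" and g: "g \<in> carrier (free_cover R M)" for f g
  proof -
    have "finite ({x. f x \<noteq> \<zero>} \<union> {x. g x \<noteq> \<zero>})"
      using f g by (simp add: free_cover_carrier)
    then have "finite {x. f x \<oplus> g x \<noteq> \<zero>}"
      by (rule rev_finite_subset) auto
    then show ?thesis using f g by (simp add: free_cover_carrier)
  qed
  have smult: "(\<lambda>x. r \<otimes> f x) \<in> carrier (free_cover R M)"
    if f: "f \<in> carrier (free_cover R M)" and r: "r \<in> carrier R" for f r
  proof -
    have "finite {x. f x \<noteq> \<zero>}"
      using f by (simp add: free_cover_carrier)
    then have "finite {x. r \<otimes> f x \<noteq> \<zero>}"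
      by (rule rev_finite_subset) (use r in auto)
    then show ?thesis using f r by (simp add: free_cover_carrier)
  qed
  show "cring R" ..
  show "abelian_group (free_cover R M)"
  proof (rule abelian_groupI)
    fix f assume f: "f \<in> carrier (free_cover R M)"
    \<comment> \<open>Negation as scaling by \<open>\<ominus> \<one>\<close> inherits finite support
      from \<open>smult\<close>.\<close>
    then have "(\<lambda>x. (\<ominus> \<one>) \<otimes> f x) \<in> carrier (free_cover R M)" by (simp add: smult)
    moreover have "(\<ominus> \<one>) \<otimes> f x \<oplus> f x = \<zero>" for x
      using f by (simp add: free_cover_carrier l_minus l_neg)
    ultimately show "\<exists>g\<in>carrier (free_cover R M). g \<oplus>\<^bsub>free_cover R M\<^esub> f = \<zero>\<^bsub>free_cover R M\<^esub>"
      by (intro bexI[of _ "\<lambda>x. (\<ominus> \<one>) \<otimes> f x"]) simp_all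
  next
    fix f g h assume "f \<in> carrier (free_cover R M)" "g \<in> carrier (free_cover R M)" "h \<in> carrier (free_cover R M)"
    then show "f \<oplus>\<^bsub>free_cover R M\<^esub> g \<oplus>\<^bsub>free_cover R M\<^esub> h =
        f \<oplus>\<^bsub>free_cover R M\<^esub> (g \<oplus>\<^bsub>free_cover R M\<^esub> h)"
      by (simp add: free_cover_carrier a_assoc)
  next
    fix f g assume "f \<in> carrier (free_cover R M)" "g \<in> carrier (free_cover R M)"
    then show "f \<oplus>\<^bsub>free_cover R M\<^esub> g = g \<oplus>\<^bsub>free_cover R M\<^esub> f"
      by (simp add: free_cover_carrier a_comm)
  qed (use add in \<open>auto simp: free_cover_carrier\<close>)
qed (auto simp: free_cover_carrier l_distr r_distr m_assoc intro: rev_finite_subset)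

text \<open>The defining sum runs over the support of \<open>f\<close>, which changes from
  \<open>f\<close> and \<open>g\<close> to their sum. Enlarging the index set only adds zero terms,
  so such sums can be compared over a common finite set.\<close>

lemma linear_extension_eq:
  assumes N: "module R N" and u: "u \<in> carrier M \<rightarrow> carrier N"
    and f: "f \<in> carrier (free_cover R M)"
    and A: "finite A" "{x. f x \<noteq> \<zero>} \<subseteq> A" "A \<subseteq> carrier M"
  shows "linear_extension R N u f = finsum N (\<lambda>x. f x \<odot>\<^bsub>N\<^esub> u x) A"
proof -
  interpret N: module R N by (fact N)
  show ?thesis
    unfolding linear_extension_def
    by (rule N.add.finprod_mono_neutral_cong_left)
      (use u f A in \<open>auto simp: free_cover_carrier Pi_def subset_iff\<close>)
qed

lemma free_cover_support:
  assumes "f \<in> carrier (free_cover R M)"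
  shows "finite {x. f x \<noteq> \<zero>}" "{x. f x \<noteq> \<zero>} \<subseteq> carrier M"
  using assms by (auto simp: free_cover_carrier)

lemma linear_extension_closed:
  assumes N: "module R N" and u: "u \<in> carrier M \<rightarrow> carrier N"
    and f: "f \<in> carrier (free_cover R M)"
  shows "linear_extension R N u f \<in> carrier N"
proof -
  interpret N: module R N by (fact N)
  show ?thesis
    unfolding linear_extension_def using u f free_cover_support(2)[OF f]
    by (intro N.finsum_closed) (auto simp: free_cover_carrier Pi_def)
qed

lemma linear_extension_add:
  assumes N: "module R N" and u: "u \<in> carrier M \<rightarrow> carrier N"
    and f: "f \<in> carrier (free_cover R M)" and g: "g \<in> carrier (free_cover R M)"
  shows "linear_extension R N u (\<lambda>x. f x \<oplus> g x) =
    linear_extension R N u f \<oplus>\<^bsub>N\<^esub> linear_extension R N u g"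
proof -
  interpret N: module R N by (fact N)
  interpret F: module R "free_cover R M" by (rule free_cover_module)
  let ?A = "{x. f x \<noteq> \<zero>} \<union> {x. g x \<noteq> \<zero>}"
  have A: "finite ?A" "?A \<subseteq> carrier M"
    using free_cover_support[OF f] free_cover_support[OF g] by auto
  have fg: "(\<lambda>x. f x \<oplus> g x) \<in> carrier (free_cover R M)"
    using F.a_closed[OF f g] by simp
  have "linear_extension R N u (\<lambda>x. f x \<oplus> g x) = finsum N (\<lambda>x. (f x \<oplus> g x) \<odot>\<^bsub>N\<^esub> u x) ?A"
    by (rule linear_extension_eq[OF N u fg A(1) _ A(2)]) auto
  also have "\<dots> = finsum N (\<lambda>x. f x \<odot>\<^bsub>N\<^esub> u x \<oplus>\<^bsub>N\<^esub> g x \<odot>\<^bsub>N\<^esub> u x) ?A"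
    using f g u A by (intro N.finsum_cong') (auto simp: free_cover_carrier N.smult_l_distr Pi_def)
  also have "\<dots> = finsum N (\<lambda>x. f x \<odot>\<^bsub>N\<^esub> u x) ?A \<oplus>\<^bsub>N\<^esub> finsum N (\<lambda>x. g x \<odot>\<^bsub>N\<^esub> u x) ?A"
    using f g u A by (intro N.finsum_addf) (auto simp: free_cover_carrier Pi_def)
  finally show ?thesis
    using linear_extension_eq[OF N u f A(1) _ A(2)] linear_extension_eq[OF N u g A(1) _ A(2)] by auto
qed

lemma linear_extension_smult:
  assumes N: "module R N" and u: "u \<in> carrier M \<rightarrow> carrier N"
    and f: "f \<in> carrier (free_cover R M)" and r: "r \<in> carrier R"
  shows "linear_extension R N u (\<lambda>x. r \<otimes> f x) = r \<odot>\<^bsub>N\<^esub> linear_extension R N u f"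
proof -
  interpret N: module R N by (fact N)
  interpret F: module R "free_cover R M" by (rule free_cover_module)
  let ?A = "{x. f x \<noteq> \<zero>}"
  note A = free_cover_support[OF f]
  have rf: "(\<lambda>x. r \<otimes> f x) \<in> carrier (free_cover R M)"
    using F.smult_closed[OF r f] by simp
  have "linear_extension R N u (\<lambda>x. r \<otimes> f x) = finsum N (\<lambda>x. (r \<otimes> f x) \<odot>\<^bsub>N\<^esub> u x) ?A"
    by (rule linear_extension_eq[OF N u rf A(1) _ A(2)]) (use r in auto)
  also have "\<dots> = finsum N (\<lambda>x. r \<odot>\<^bsub>N\<^esub> (f x \<odot>\<^bsub>N\<^esub> u x)) ?A"
    using f r u A by (intro N.finsum_cong') (auto simp: free_cover_carrier N.smult_assoc1 Pi_def)
  also have "\<dots> = r \<odot>\<^bsub>N\<^esub> finsum N (\<lambda>x. f x \<odot>\<^bsub>N\<^esub> u x) ?A"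
    by (rule N.finsum_smult_ldistr[symmetric])
      (use f r u A in \<open>auto simp: free_cover_carrier Pi_def\<close>)
  finally show ?thesis by (simp add: linear_extension_def)
qed

lemma delta_closed: "x \<in> carrier M \<Longrightarrow> delta R x \<in> carrier (free_cover R M)"
  by (auto simp: free_cover_carrier delta_def)

lemma linear_extension_delta:
  fixes M :: "('a, 'm, 'c) module_scheme"
  assumes N: "module R N" and u: "u \<in> carrier M \<rightarrow> carrier N" and x: "x \<in> carrier M"
  shows "linear_extension R N u (delta R x) = u x"
proof -
  interpret N: module R N by (fact N)
  have "linear_extension R N u (delta R x) = finsum N (\<lambda>y. delta R x y \<odot>\<^bsub>N\<^esub> u y) {x}"
    by (rule linear_extension_eq[OF N u delta_closed[OF x]]) (use x in \<open>auto simp: delta_def\<close>)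
  also have "\<dots> = u x" using u x by (simp add: delta_def Pi_def)
  finally show ?thesis .
qed

lemma cover_map_closed:
    "\<lbrakk>module R M; f \<in> carrier (free_cover R M)\<rbrakk> \<Longrightarrow> cover_map R M f \<in> carrier M"
  and cover_map_add: "\<lbrakk>module R M; f \<in> carrier (free_cover R M); g \<in> carrier (free_cover R M)\<rbrakk>
    \<Longrightarrow> cover_map R M (\<lambda>x. f x \<oplus> g x) = cover_map R M f \<oplus>\<^bsub>M\<^esub> cover_map R M g"
  and cover_map_smult: "\<lbrakk>module R M; f \<in> carrier (free_cover R M); r \<in> carrier R\<rbrakk>
    \<Longrightarrow> cover_map R M (\<lambda>x. r \<otimes> f x) = r \<odot>\<^bsub>M\<^esub> cover_map R M f"
  and cover_map_delta: "\<lbrakk>module R M; x \<in> carrier M\<rbrakk> \<Longrightarrow> cover_map R M (delta R x) = x"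
  unfolding cover_map_eq
  by (rule linear_extension_closed linear_extension_add linear_extension_smult
      linear_extension_delta; simp)+

text \<open>Additive inverses in a record are given only by their inverse property; this explicit
  form reduces closure of the syzygies under inverses to \<open>cover_map_smult\<close>.\<close>

lemma free_cover_minus:
  assumes f: "f \<in> carrier (free_cover R M)"
  shows "\<ominus>\<^bsub>free_cover R M\<^esub> f = (\<lambda>x. (\<ominus> \<one>) \<otimes> f x)"
proof -
  interpret F: module R "free_cover R M" by (rule free_cover_module)
  show ?thesis using F.smult_l_minus[OF one_closed f] f F.smult_one[OF f] by simp
qed

lemma syzygy_module:
  assumes M: "module R M"
  shows "module R (syzygy R M)"
proof -
  interpret M: module R M by (fact M)
  interpret F: module R "free_cover R M" by (rule free_cover_module)
  have zero: "cover_map R M (\<lambda>x. \<zero>) = \<zero>\<^bsub>M\<^esub>" by (simp add: cover_map_def)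
  have "submodule {f \<in> carrier (free_cover R M). cover_map R M f = \<zero>\<^bsub>M\<^esub>} R (free_cover R M)"
  proof (rule F.submoduleI, goal_cases)
    case (3 f)
    then show ?case
      using F.a_inv_closed[of f] cover_map_smult[OF M, of f "\<ominus> \<one>"] by (simp add: free_cover_minus)
  next
    case (4 f g)
    then show ?case using F.a_closed[of f g] by (simp add: cover_map_add[OF M])
  next
    case (5 r f)
    then show ?case using F.smult_closed[of r f] by (simp add: cover_map_smult[OF M])
  qed (use F.zero_closed zero in auto)
  then show ?thesis
    unfolding syzygy_def by (rule submodule.submodule_is_module) (rule free_cover_module)
qed

section \<open>Cocycles and coboundaries\<close>

lemma mod_hom_zero:
  assumes "module R M" "module R N" and \<phi>: "\<phi> \<in> mod_hom R M N"
  shows "\<phi> \<zero>\<^bsub>M\<^esub> = \<zero>\<^bsub>N\<^esub>"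
proof -
  interpret M: module R M by fact
  interpret N: module R N by fact
  show ?thesis
    using mod_hom_smult[OF \<phi> zero_closed M.zero_closed] mod_hom_carrier[OF \<phi> M.zero_closed] by simp
qed

text \<open>The cover map of the second syzygy module is onto, since \<open>delta R h\<close> goes
  to \<open>h\<close>; so vanishing after composition with it is vanishing on the second syzygies
  themselves. The free cover \<open>F2\<close> disappears, and a cocycle is a map on
  \<open>F1\<close> that descends to the first syzygies.\<close>

lemma Ext1_cocycles_iff:
  assumes M: "module R M" and N: "module R N"
  shows "\<phi> \<in> Ext1_cocycles R M N \<longleftrightarrow>
    \<phi> \<in> mod_hom R (free_cover R (syzygy R M)) N \<and>
    (\<forall>h \<in> carrier (syzygy R (syzygy R M)). \<phi> h = \<zero>\<^bsub>N\<^esub>)"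
proof -
  define L where "L = syzygy R (syzygy R M)"
  have L: "module R L" unfolding L_def by (intro syzygy_module M)
  have "compose (carrier (free_cover R L)) \<phi> (cover_map R L) = (\<lambda>x\<in>carrier (free_cover R L). \<zero>\<^bsub>N\<^esub>)
      \<longleftrightarrow> (\<forall>h \<in> carrier L. \<phi> h = \<zero>\<^bsub>N\<^esub>)" (is "?l = ?r")
  proof
    assume l: ?l
    show ?r
    proof
      fix h assume h: "h \<in> carrier L"
      from l have "compose (carrier (free_cover R L)) \<phi> (cover_map R L) (delta R h) = \<zero>\<^bsub>N\<^esub>"
        using delta_closed[OF h] by simp
      then show "\<phi> h = \<zero>\<^bsub>N\<^esub>"
        using delta_closed[OF h] cover_map_delta[OF L h] by (simp add: compose_def)
    qed
  next
    assume ?r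
    then show ?l
      by (auto simp: compose_def fun_eq_iff cover_map_closed[OF L])
  qed
  then show ?thesis
    unfolding L_def by (simp add: Ext1_cocycles_def Let_def Hom_group_def)
qed

text \<open>Homomorphisms are extensional functions, so the pointwise operations are restricted to
  the carrier and the unit law must also compare the values outside it.\<close>

lemma Ext1_cocycles_group:
  assumes M: "module R M" and N: "module R N"
  shows "group ((Hom_group R (free_cover R (syzygy R M)) N)\<lparr>carrier := Ext1_cocycles R M N\<rparr>)"
proof -
  let ?F = "free_cover R (syzygy R M)"
  let ?Z = "Ext1_cocycles R M N"
  note iff = Ext1_cocycles_iff[OF M N]
  interpret N: module R N by (fact N)
  interpret F: module R ?F by (rule free_cover_module)
  have LF: "carrier (syzygy R (syzygy R M)) \<subseteq> carrier ?F"
    by (auto simp: syzygy_carrier)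
  have Z: "\<phi> \<in> mod_hom R ?F N" if "\<phi> \<in> ?Z" for \<phi>
    using that unfolding iff by (rule conjunct1)
  note zc = mod_hom_carrier[OF Z] mod_hom_add[OF Z] mod_hom_smult[OF Z]
  have add: "(\<lambda>x\<in>carrier ?F. \<phi> x \<oplus>\<^bsub>N\<^esub> \<psi> x) \<in> ?Z" if "\<phi> \<in> ?Z" "\<psi> \<in> ?Z" for \<phi> \<psi>
    unfolding iff
  proof (intro conjI mod_homI ballI)
    fix h assume "h \<in> carrier (syzygy R (syzygy R M))"
    then show "(\<lambda>x\<in>carrier ?F. \<phi> x \<oplus>\<^bsub>N\<^esub> \<psi> x) h = \<zero>\<^bsub>N\<^esub>"
      using LF that by (auto simp: iff)
  qed (use that F.a_closed F.smult_closed in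
    \<open>auto simp: zc N.smult_r_distr N.a_ac simp del: free_cover_simps\<close>)
  have zero: "(\<lambda>x\<in>carrier ?F. \<zero>\<^bsub>N\<^esub>) \<in> ?Z"
    unfolding iff
  proof (intro conjI mod_homI ballI)
    fix h assume "h \<in> carrier (syzygy R (syzygy R M))"
    then show "(\<lambda>x\<in>carrier ?F. \<zero>\<^bsub>N\<^esub>) h = \<zero>\<^bsub>N\<^esub>"
      using LF by auto
  qed (use F.a_closed F.smult_closed in \<open>auto simp del: free_cover_simps\<close>)
  have neg: "(\<lambda>x\<in>carrier ?F. \<ominus>\<^bsub>N\<^esub> \<phi> x) \<in> ?Z" if "\<phi> \<in> ?Z" for \<phi>
    unfolding iff
  proof (intro conjI mod_homI ballI)
    fix h assume "h \<in> carrier (syzygy R (syzygy R M))"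
    then show "(\<lambda>x\<in>carrier ?F. \<ominus>\<^bsub>N\<^esub> \<phi> x) h = \<zero>\<^bsub>N\<^esub>"
      using LF that by (auto simp: iff)
  qed (use that F.a_closed F.smult_closed in
    \<open>auto simp: zc N.minus_add N.smult_r_minus simp del: free_cover_simps\<close>)
  have ext: "\<phi> \<in> extensional (carrier ?F)" if "\<phi> \<in> ?Z" for \<phi>
    using that mod_hom_ext unfolding iff by blast
  show ?thesis
  proof (rule groupI, goal_cases)
    case (3 f g h)
    then show ?case
      by (auto simp: Hom_group_def fun_eq_iff zc restrict_def N.a_assoc)
  next
    case (4 f)
    then show ?case
      by (auto simp: Hom_group_def fun_eq_iff zc restrict_def extensional_arb[OF ext])
  next
    case (5 f)
    then have f: "f \<in> ?Z" by simp
    show ?case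
      by (rule bexI[of _ "\<lambda>x\<in>carrier ?F. \<ominus>\<^bsub>N\<^esub> f x"])
        (simp_all add: neg[OF f] Hom_group_def fun_eq_iff zc[OF f] N.l_neg)
  qed (auto simp: Hom_group_def add zero)
qed

text \<open>This is the complex property: the cover map of \<open>K\<close> is zero on
  \<open>syzygy R K\<close> by definition, and \<open>\<psi>\<close> sends zero to zero.\<close>

lemma Ext1_coboundaries_subset:
  assumes M: "module R M" and N: "module R N"
  shows "Ext1_coboundaries R M N \<subseteq> Ext1_cocycles R M N"
proof
  fix \<phi> assume "\<phi> \<in> Ext1_coboundaries R M N"
  define K where "K = syzygy R M"
  have K: "module R K" unfolding K_def by (rule syzygy_module[OF M])
  interpret F1: module R "free_cover R K" by (rule free_cover_module)
  from \<open>\<phi> \<in> _\<close> obtain \<psi> where \<psi>: "\<psi> \<in> mod_hom R (free_cover R M) N"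
    and \<phi>: "\<phi> = compose (carrier (free_cover R K)) \<psi> (cover_map R K)"
    by (auto simp: Ext1_coboundaries_def Let_def K_def)
  have c: "cover_map R K f \<in> carrier (free_cover R M)" if "f \<in> carrier (free_cover R K)" for f
    using cover_map_closed[OF K that] by (simp add: K_def syzygy_carrier)
  have ca: "cover_map R K (\<lambda>x. f x \<oplus> g x) = cover_map R K f \<oplus>\<^bsub>free_cover R M\<^esub> cover_map R K g"
    if "f \<in> carrier (free_cover R K)" "g \<in> carrier (free_cover R K)" for f g
    using cover_map_add[OF K that] by (simp add: K_def)
  have cs: "cover_map R K (\<lambda>x. r \<otimes> f x) = r \<odot>\<^bsub>free_cover R M\<^esub> cover_map R K f"
    if "f \<in> carrier (free_cover R K)" "r \<in> carrier R" for r f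
    using cover_map_smult[OF K that] by (simp add: K_def)
  have \<psi>a: "\<psi> (\<lambda>x. f x \<oplus> g x) = \<psi> f \<oplus>\<^bsub>N\<^esub> \<psi> g"
    if "f \<in> carrier (free_cover R M)" "g \<in> carrier (free_cover R M)" for f g
    using mod_hom_add[OF \<psi> that] by simp
  have \<psi>s: "\<psi> (\<lambda>x. r \<otimes> f x) = r \<odot>\<^bsub>N\<^esub> \<psi> f"
    if "f \<in> carrier (free_cover R M)" "r \<in> carrier R" for f r
    using mod_hom_smult[OF \<psi> that(2,1)] by simp
  have "\<psi> (\<lambda>x. \<zero>) = \<zero>\<^bsub>N\<^esub>"
    using mod_hom_zero[OF free_cover_module N \<psi>] by simp
  then have "\<forall>h\<in>carrier (syzygy R K). \<phi> h = \<zero>\<^bsub>N\<^esub>"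
    by (auto simp: \<phi> syzygy_carrier compose_def K_def)
  moreover have "\<phi> \<in> mod_hom R (free_cover R K) N"
    using F1.a_closed F1.smult_closed
    by (intro mod_homI)
      (auto simp: \<phi> compose_def c ca cs mod_hom_carrier[OF \<psi>] \<psi>a \<psi>s)
  ultimately show "\<phi> \<in> Ext1_cocycles R M N"
    by (simp add: Ext1_cocycles_iff[OF M N] K_def)
qed

lemma trivial_Ext1I:
  assumes M: "module R M" and N: "module R N"
    and sub: "Ext1_cocycles R M N \<subseteq> Ext1_coboundaries R M N"
  shows "trivial_group (Ext1 R M N)"
proof -
  let ?G = "(Hom_group R (free_cover R (syzygy R M)) N)\<lparr>carrier := Ext1_cocycles R M N\<rparr>"
  have "Ext1_coboundaries R M N = carrier ?G"
    using sub Ext1_coboundaries_subset[OF M N] by simp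
  then have "Ext1 R M N = ?G Mod carrier ?G" by (simp add: Ext1_def)
  then show ?thesis
    using group.trivial_factor_self[OF Ext1_cocycles_group[OF M N]] by simp
qed

section \<open>The modules R and R/I, and Ext for principal I\<close>

lemma regular_module_simps [simp]:
  "carrier (regular_module R) = carrier R"
  "\<zero>\<^bsub>regular_module R\<^esub> = \<zero>"
  "x \<oplus>\<^bsub>regular_module R\<^esub> y = x \<oplus> y"
  "r \<odot>\<^bsub>regular_module R\<^esub> x = r \<otimes> x"
  by (simp_all add: regular_module_def restrict_scalars_def)

lemma regular_module: "module R (regular_module R)"
proof (rule moduleI)
  show "cring R" ..
  show "abelian_group (regular_module R)"
  proof (rule abelian_groupI)
    fix x assume "x \<in> carrier (regular_module R)"
    then show "\<exists>y\<in>carrier (regular_module R). y \<oplus>\<^bsub>regular_module R\<^esub> x = \<zero>\<^bsub>regular_module R\<^esub>"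
      by (intro bexI[of _ "\<ominus> x"]) (simp_all add: l_neg)
  qed (auto simp: a_ac)
qed (auto simp: l_distr r_distr m_assoc)

lemma quotient_module_simps [simp]:
  "carrier (quotient_module R I) = carrier (R Quot I)"
  "\<zero>\<^bsub>quotient_module R I\<^esub> = \<zero>\<^bsub>R Quot I\<^esub>"
  "x \<oplus>\<^bsub>quotient_module R I\<^esub> y = x \<oplus>\<^bsub>R Quot I\<^esub> y"
  "r \<odot>\<^bsub>quotient_module R I\<^esub> x = (I +> r) \<otimes>\<^bsub>R Quot I\<^esub> x"
  by (simp_all add: quotient_module_def restrict_scalars_def)

text \<open>\<open>finsum\<close> sees only carrier, addition and zero, which the module copies from
  the quotient ring; sums can thus be pushed through the ring homomorphism R -> R/I.\<close>

lemma finsum_quotient_module: "finsum (quotient_module R I) = finsum (R Quot I)"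
  by (simp add: fun_eq_iff finsum_def finprod_def quotient_module_def restrict_scalars_def)

lemma quotient_module:
  assumes I: "ideal I R"
  shows "module R (quotient_module R I)"
proof -
  interpret Q: ring_hom_cring R "R Quot I" "(+>) I"
    using I is_cring by (rule ideal.rcos_ring_hom_cring)
  show ?thesis
  proof (rule moduleI)
    show "cring R" ..
    show "abelian_group (quotient_module R I)"
    proof (rule abelian_groupI)
      fix x assume "x \<in> carrier (quotient_module R I)"
      then show "\<exists>y\<in>carrier (quotient_module R I). y \<oplus>\<^bsub>quotient_module R I\<^esub> x = \<zero>\<^bsub>quotient_module R I\<^esub>"
        by (intro bexI[of _ "\<ominus>\<^bsub>R Quot I\<^esub> x"]) (simp_all add: Q.S.l_neg)
    qed (auto simp: Q.S.a_ac)
  qed (simp_all add: Q.S.l_distr Q.S.r_distr Q.S.m_assoc Q.hom_one)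
qed

text \<open>Each summand \<open>f x\<close> times \<open>x\<close> is the class of
  \<open>f x \<otimes> s x\<close>. Hence a choice of representatives lifts the cover map to a
  linear map from the free cover to R.\<close>

lemma cover_map_quotient_module:
  assumes I: "ideal I R"
    and s: "\<And>x. x \<in> carrier (R Quot I) \<Longrightarrow> s x \<in> carrier R \<and> I +> s x = x"
    and f: "f \<in> carrier (free_cover R (quotient_module R I))"
  shows "cover_map R (quotient_module R I) f = I +> (finsum R (\<lambda>x. f x \<otimes> s x) {x. f x \<noteq> \<zero>})"
proof -
  interpret Q: ring_hom_cring R "R Quot I" "(+>) I"
    using I is_cring by (rule ideal.rcos_ring_hom_cring)
  let ?A = "{x. f x \<noteq> \<zero>}"
  have fR: "f x \<in> carrier R" for x using f by (simp add: free_cover_carrier)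
  have A: "finite ?A" "?A \<subseteq> carrier (R Quot I)"
    using free_cover_support[OF f] by auto
  have "cover_map R (quotient_module R I) f = finsum (R Quot I) (\<lambda>x. (I +> f x) \<otimes>\<^bsub>R Quot I\<^esub> x) ?A"
    by (simp add: cover_map_def finsum_quotient_module)
  also have "\<dots> = finsum (R Quot I) ((+>) I \<circ> (\<lambda>x. f x \<otimes> s x)) ?A"
    using A s fR by (intro Q.S.finsum_cong') (auto simp: Q.hom_mult)
  also have "\<dots> = I +> (finsum R (\<lambda>x. f x \<otimes> s x) ?A)"
    using A s fR by (intro Q.hom_finsum[symmetric]) auto
  finally show ?thesis .
qed

lemma quotient_repr:
  assumes "x \<in> carrier (R Quot I)"
  shows "\<exists>r \<in> carrier R. I +> r = x"
  using assms by (auto simp: FactRing_simps)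

text \<open>A cocycle amounts to a linear map \<open>g\<close> on the syzygies \<open>K\<close> of
  the free module over all of R/I. Inside \<open>K\<close> sits the ideal I as its multiples of
  \<open>e\<close>, and \<open>g\<close> restricted there is the homomorphism (a) -> R to which the
  colon condition applies. The remaining work is to extend \<open>g\<close> from \<open>K\<close> to
  the whole free module.\<close>

theorem trivial_Ext1_quotient_principal:
  assumes a: "a \<in> carrier R"
    and colon: "colon R {\<zero>} (colon R {\<zero>} {a}) \<subseteq> PIdl a"
  shows "trivial_group (Ext1 R (quotient_module R (PIdl a)) (regular_module R))"
proof -
  define I where "I = PIdl a"
  have I: "ideal I R" unfolding I_def by (rule cgenideal_ideal[OF a])
  interpret I: ideal I R by (fact I)
  interpret Q: ring_hom_cring R "R Quot I" "(+>) I"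
    using I is_cring by (rule ideal.rcos_ring_hom_cring)
  define M where "M = quotient_module R I"
  define N where "N = regular_module R"
  have M: "module R M" unfolding M_def by (rule quotient_module[OF I])
  have N: "module R N" unfolding N_def by (rule regular_module)
  have N_simps [simp]: "carrier N = carrier R" "\<zero>\<^bsub>N\<^esub> = \<zero>"
    "x \<oplus>\<^bsub>N\<^esub> y = x \<oplus> y" "r \<odot>\<^bsub>N\<^esub> x = r \<otimes> x" for x y r
    by (simp_all add: N_def)
  define K where "K = syzygy R M"
  have K: "module R K" unfolding K_def by (rule syzygy_module[OF M])
  let ?F0 = "free_cover R M" and ?F1 = "free_cover R K"
  interpret M: module R M by (fact M)
  interpret K: module R K by (fact K)
  interpret F0: module R ?F0 by (rule free_cover_module)
  interpret F1: module R ?F1 by (rule free_cover_module)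
  have K_simps [simp]: "\<zero>\<^bsub>K\<^esub> = (\<lambda>x. \<zero>)" "f \<oplus>\<^bsub>K\<^esub> g = (\<lambda>x. f x \<oplus> g x)"
      "r \<odot>\<^bsub>K\<^esub> f = (\<lambda>x. r \<otimes> f x)" for f g r
    by (simp_all add: K_def)
  have KF0: "f \<in> carrier ?F0" if "f \<in> carrier K" for f
    using that by (simp add: K_def syzygy_carrier)
  have F0R [simp]: "f x \<in> carrier R" if "f \<in> carrier ?F0" for f x
    using that by (simp add: free_cover_carrier)
  define e where "e = delta R (I +> \<one>)"
  have e: "e \<in> carrier ?F0"
    unfolding e_def by (intro delta_closed) (simp add: M_def)
  \<comment> \<open>The multiples of \<open>e\<close> form a copy of R in the free cover on which
    the cover map is R -> R/I.\<close>
  have cover_e: "cover_map R M (\<lambda>x. r \<otimes> e x) = I +> r" if "r \<in> carrier R" for r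
  proof -
    have "cover_map R M (\<lambda>x. r \<otimes> e x) = r \<odot>\<^bsub>M\<^esub> cover_map R M e"
      by (rule cover_map_smult[OF M e that])
    also have "cover_map R M e = I +> \<one>"
      unfolding e_def by (rule cover_map_delta[OF M]) (simp add: M_def)
    also have "r \<odot>\<^bsub>M\<^esub> (I +> \<one>) = (I +> r) \<otimes>\<^bsub>R Quot I\<^esub> (I +> \<one>)"
      by (simp add: M_def)
    also have "\<dots> = I +> (r \<otimes> \<one>)"
      using that by (intro Q.hom_mult[symmetric]) auto
    finally show ?thesis using that by simp
  qed
  \<comment> \<open>\<open>s\<close> is only a set-theoretic section; linearity is regained by
    extending it from the basis of the free cover.\<close>
  obtain s where s: "\<And>x. x \<in> carrier (R Quot I) \<Longrightarrow> s x \<in> carrier R \<and> I +> s x = x"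
    using bchoice[of "carrier (R Quot I)" "\<lambda>x r. r \<in> carrier R \<and> I +> r = x"] quotient_repr[of _ I] by blast
  have s_Pi: "s \<in> carrier M \<rightarrow> carrier N" using s by (auto simp: M_def)
  txt \<open>\<open>\<theta>\<close> lifts the cover map along $R \to R/I$, so that \<open>P\<close> projects the cover to the syzygies.\<close>
  define \<theta> where "\<theta> = linear_extension R N s"
  have \<theta>_closed: "\<theta> f \<in> carrier R" if "f \<in> carrier ?F0" for f
    using linear_extension_closed[OF N s_Pi that] by (simp add: \<theta>_def)
  have \<theta>_add: "\<theta> (\<lambda>x. f x \<oplus> g x) = \<theta> f \<oplus> \<theta> g" if "f \<in> carrier ?F0" "g \<in> carrier ?F0" for f g
    using linear_extension_add[OF N s_Pi that] by (simp add: \<theta>_def)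
  have \<theta>_smult: "\<theta> (\<lambda>x. r \<otimes> f x) = r \<otimes> \<theta> f" if "f \<in> carrier ?F0" "r \<in> carrier R" for f r
    using linear_extension_smult[OF N s_Pi that] by (simp add: \<theta>_def)
  have cover_\<theta>: "cover_map R M f = I +> \<theta> f" if "f \<in> carrier ?F0" for f
    using cover_map_quotient_module[OF I s, of f] that
    by (simp add: M_def \<theta>_def linear_extension_def finsum_def finprod_def N_def regular_module_def restrict_scalars_def)
  define P where "P f = (\<lambda>x. f x \<oplus> (\<ominus> \<theta> f) \<otimes> e x)" for f
  \<comment> \<open>\<open>f\<close> and the multiple of \<open>e\<close> by
    \<open>\<theta> f\<close> have the same image \<open>I +> \<theta> f\<close>, so their
    difference is a syzygy.\<close>
  have P: "P f \<in> carrier K" if f: "f \<in> carrier ?F0" for f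
  proof -
    have re: "(\<lambda>x. (\<ominus> \<theta> f) \<otimes> e x) \<in> carrier ?F0"
      using F0.smult_closed[OF _ e, of "\<ominus> \<theta> f"] \<theta>_closed[OF f] by simp
    have "cover_map R M (P f) = (I +> \<theta> f) \<oplus>\<^bsub>R Quot I\<^esub> (I +> (\<ominus> \<theta> f))"
      unfolding P_def using cover_map_add[OF M f re] cover_e[of "\<ominus> \<theta> f"] cover_\<theta>[OF f] \<theta>_closed[OF f]
      by (simp add: M_def)
    also have "\<dots> = I +> (\<theta> f \<oplus> (\<ominus> \<theta> f))"
      using \<theta>_closed[OF f] by (intro Q.hom_add[symmetric]) auto
    also have "\<dots> = \<zero>\<^bsub>M\<^esub>" using \<theta>_closed[OF f] by (simp add: r_neg M_def)
    finally show ?thesis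
      using F0.a_closed[OF f re] by (simp add: K_def syzygy_carrier P_def)
  qed
  have "Ext1_cocycles R M N \<subseteq> Ext1_coboundaries R M N"
  proof
    fix \<phi> assume "\<phi> \<in> Ext1_cocycles R M N"
    then have \<phi>: "\<phi> \<in> mod_hom R ?F1 N"
      and \<phi>0: "\<And>h. \<lbrakk>h \<in> carrier ?F1; cover_map R K h = \<zero>\<^bsub>K\<^esub>\<rbrakk> \<Longrightarrow> \<phi> h = \<zero>"
      by (simp_all add: Ext1_cocycles_iff[OF M N] K_def syzygy_carrier)
    \<comment> \<open>The difference of \<open>f\<close> and \<open>g\<close> is a second syzygy,
      where a cocycle vanishes.\<close>
    have \<phi>_cong: "\<phi> f = \<phi> g"
      if f: "f \<in> carrier ?F1" and g: "g \<in> carrier ?F1" and fg: "cover_map R K f = cover_map R K g" for f g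
    proof -
      let ?h = "\<ominus>\<^bsub>?F1\<^esub> g"
      have h: "?h \<in> carrier ?F1" using g by (rule F1.a_inv_closed)
      have 1: "cover_map R K (u \<oplus>\<^bsub>?F1\<^esub> ?h) = cover_map R K u \<oplus>\<^bsub>K\<^esub> cover_map R K ?h"
        if "u \<in> carrier ?F1" for u
        using cover_map_add[OF K that h] by simp
      have "cover_map R K (f \<oplus>\<^bsub>?F1\<^esub> ?h) = cover_map R K (g \<oplus>\<^bsub>?F1\<^esub> ?h)"
        using f g fg by (simp only: 1)
      also have "\<dots> = \<zero>\<^bsub>K\<^esub>"
        unfolding F1.r_neg[OF g] by (simp add: cover_map_def)
      finally have "\<phi> (f \<oplus>\<^bsub>?F1\<^esub> ?h) = \<zero>" using \<phi>0 F1.a_closed[OF f h] by blast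
      then have "\<phi> f \<oplus> \<phi> ?h = \<zero>" using mod_hom_add[OF \<phi> f h] by simp
      moreover have "\<phi> g \<oplus> \<phi> ?h = \<zero>"
        using mod_hom_add[OF \<phi> g h] mod_hom_zero[OF free_cover_module N \<phi>]
        by (simp add: F1.r_neg[OF g] del: free_cover_simps(2))
      ultimately show ?thesis
        using mod_hom_carrier[OF \<phi>] f g h by (metis N_simps(1) add.r_cancel)
    qed
    \<comment> \<open>The map induced by \<open>\<phi>\<close> on \<open>K\<close>. The basis
      element over \<open>h\<close> is one choice of preimage; independence of the choice,
      \<open>\<phi>_cong\<close>, is what makes \<open>g\<close> linear.\<close>
    define g where "g h = \<phi> (delta R h)" for h
    have d: "delta R h \<in> carrier ?F1" if "h \<in> carrier K" for h
      by (rule delta_closed[OF that])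
    have g_closed [simp]: "g h \<in> carrier R" if "h \<in> carrier K" for h
      using mod_hom_carrier[OF \<phi> d[OF that]] by (simp add: g_def)
    have g_cover: "\<phi> f = g (cover_map R K f)" if f: "f \<in> carrier ?F1" for f
      unfolding g_def using cover_map_closed[OF K f]
      by (intro \<phi>_cong f d) (simp_all add: cover_map_delta[OF K])
    have g_add: "g (\<lambda>x. h x \<oplus> h' x) = g h \<oplus> g h'" if h: "h \<in> carrier K" "h' \<in> carrier K" for h h'
      using g_cover[OF F1.a_closed[OF d[OF h(1)] d[OF h(2)]]] mod_hom_add[OF \<phi> d[OF h(1)] d[OF h(2)]]
        cover_map_add[OF K d[OF h(1)] d[OF h(2)]] cover_map_delta[OF K h(1)] cover_map_delta[OF K h(2)]
      by (simp add: g_def)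
    have g_smult: "g (\<lambda>x. r \<otimes> h x) = r \<otimes> g h" if h: "h \<in> carrier K" and r: "r \<in> carrier R" for h r
      using g_cover[OF F1.smult_closed[OF r d[OF h]]] mod_hom_smult[OF \<phi> r d[OF h]]
        cover_map_smult[OF K d[OF h] r] cover_map_delta[OF K h]
      by (simp add: g_def)
    \<comment> \<open>The syzygy corresponding to the generator \<open>a\<close> of I;
      \<open>g ae\<close> is the image of \<open>a\<close> under the induced homomorphism (a) ->
      R.\<close>
    define ae where "ae = (\<lambda>x. a \<otimes> e x)"
    have ae: "ae \<in> carrier K"
    proof -
      have "a \<in> I" unfolding I_def by (rule cgenideal_self[OF a])
      have "cover_map R M ae = I +> a" using cover_e[OF a] by (simp add: ae_def)
      also have "\<dots> = I" using \<open>a \<in> I\<close> by (rule I.a_rcos_const)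
      also have "\<dots> = \<zero>\<^bsub>M\<^esub>" unfolding M_def quotient_module_simps FactRing_def by simp
      finally have "cover_map R M ae = \<zero>\<^bsub>M\<^esub>" .
      moreover have "ae \<in> carrier ?F0" using F0.smult_closed[OF a e] by (simp add: ae_def)
      ultimately show ?thesis unfolding K_def syzygy_carrier by (intro conjI)
    qed
    have "g ae \<in> colon R {\<zero>} (colon R {\<zero>} {a})"
    proof -
      \<comment> \<open>If \<open>z\<close> kills \<open>a\<close>, then \<open>z\<close> times
        \<open>ae\<close> is the zero syzygy, and linearity of \<open>g\<close> gives the
        claim.\<close>
      have "g ae \<otimes> z = \<zero>" if z: "z \<in> carrier R" "z \<otimes> a = \<zero>" for z
      proof -
        have "(\<lambda>x. z \<otimes> ae x) = (\<lambda>x. \<zero> \<otimes> ae x)"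
          unfolding ae_def using z a e by (simp add: m_assoc[symmetric])
        then have "z \<otimes> g ae = \<zero> \<otimes> g ae" using g_smult[OF ae] z by (metis zero_closed)
        then show ?thesis using g_closed[OF ae] z by (simp add: m_comm)
      qed
      then show ?thesis using g_closed[OF ae] by (auto simp: colon_def)
    qed
    txt \<open>Multiplication by \<open>t\<close> extends the homomorphism induced by \<open>\<phi>\<close> on $(a)$ to $R$.\<close>
    then obtain t where t: "t \<in> carrier R" "g ae = t \<otimes> a"
      using colon by (auto simp: cgenideal_def)
    define \<psi> where "\<psi> = (\<lambda>f\<in>carrier ?F0. g (P f) \<oplus> \<theta> f \<otimes> t)"
    have "\<psi> \<in> mod_hom R ?F0 N"
    proof (rule mod_homI)
      fix f f' assume f: "f \<in> carrier ?F0" and f': "f' \<in> carrier ?F0"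
      have "P (\<lambda>x. f x \<oplus> f' x) = (\<lambda>x. P f x \<oplus> P f' x)"
        using f f' e \<theta>_closed[OF f] \<theta>_closed[OF f']
        by (simp add: fun_eq_iff P_def \<theta>_add minus_add l_distr a_ac)
      then have "g (P (\<lambda>x. f x \<oplus> f' x)) = g (P f) \<oplus> g (P f')"
        by (simp add: g_add P f f')
      then show "\<psi> (f \<oplus>\<^bsub>?F0\<^esub> f') = \<psi> f \<oplus>\<^bsub>N\<^esub> \<psi> f'"
        using F0.a_closed[OF f f'] f f' t \<theta>_closed[OF f] \<theta>_closed[OF f'] P
        by (simp add: \<psi>_def \<theta>_add l_distr a_ac)
    next
      fix r f assume r: "r \<in> carrier R" and f: "f \<in> carrier ?F0"
      have "P (\<lambda>x. r \<otimes> f x) = (\<lambda>x. r \<otimes> P f x)"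
        using f r e \<theta>_closed[OF f]
        by (simp add: fun_eq_iff P_def \<theta>_smult r_distr m_assoc flip: r_minus)
      then have "g (P (\<lambda>x. r \<otimes> f x)) = r \<otimes> g (P f)"
        by (simp add: g_smult P f r)
      then show "\<psi> (r \<odot>\<^bsub>?F0\<^esub> f) = r \<odot>\<^bsub>N\<^esub> \<psi> f"
        using F0.smult_closed[OF r f] f r t \<theta>_closed[OF f] P
        by (simp add: \<psi>_def \<theta>_smult r_distr m_assoc)
    qed (use t \<theta>_closed P in \<open>auto simp: \<psi>_def\<close>)
    moreover have "\<phi> = compose (carrier ?F1) \<psi> (cover_map R K)"
    proof (rule extensionalityI[OF mod_hom_ext[OF \<phi>] compose_extensional])
      fix f assume f: "f \<in> carrier ?F1"
      define h where "h = cover_map R K f"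
      have h: "h \<in> carrier K" unfolding h_def by (rule cover_map_closed[OF K f])
      note hF = KF0[OF h]
      \<comment> \<open>For a syzygy \<open>h\<close> the lift \<open>\<theta> h\<close> represents
        zero in R/I, hence is a multiple \<open>r \<otimes> a\<close>.\<close>
      have "I +> \<theta> h = \<zero>\<^bsub>M\<^esub>"
        using h cover_\<theta>[OF hF] by (simp add: K_def syzygy_carrier)
      then have "I +> \<theta> h = I"
        unfolding M_def quotient_module_simps FactRing_def by simp
      then have "\<theta> h \<in> I" by (rule I.rcos_const_imp_mem[OF \<theta>_closed[OF hF]])
      then obtain r where r: "r \<in> carrier R" "\<theta> h = r \<otimes> a"
        unfolding I_def cgenideal_def by blast
      \<comment> \<open>\<open>P\<close> does not fix \<open>K\<close>: it subtracts
        \<open>r\<close> times \<open>ae\<close>, so \<open>g (P h)\<close> falls short of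
        \<open>g h\<close> by \<open>r \<otimes> g ae\<close>. By the choice of \<open>t\<close>
        this is \<open>\<theta> h \<otimes> t\<close>, the second term in
        \<open>\<psi>\<close>.\<close>
      have "P h = (\<lambda>x. h x \<oplus> (\<ominus> r) \<otimes> ae x)"
        using hF e r a by (simp add: P_def ae_def l_minus m_assoc)
      then have "g (P h) = g h \<oplus> (\<ominus> r) \<otimes> g ae"
        using g_add[OF h, of "\<lambda>x. (\<ominus> r) \<otimes> ae x"] g_smult[OF ae, of "\<ominus> r"] K.smult_closed[OF _ ae, of "\<ominus> r"] r
        by simp
      moreover have "\<theta> h \<otimes> t = r \<otimes> g ae" using r t a by (simp add: m_ac)
      ultimately have "g (P h) \<oplus> \<theta> h \<otimes> t = g h"
        using r ae h by (simp add: l_minus a_assoc l_neg)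
      then show "\<phi> f = compose (carrier ?F1) \<psi> (cover_map R K) f"
        using f hF by (simp add: compose_def \<psi>_def g_cover flip: h_def)
    qed
    ultimately show "\<phi> \<in> Ext1_coboundaries R M N"
      by (auto simp: Ext1_coboundaries_def Let_def K_def)
  qed
  then show ?thesis
    using trivial_Ext1I[OF M N] by (simp add: M_def N_def I_def)
qed

end

section \<open>Polynomials and monomials\<close>

lemma S_carrier: "p \<in> carrier (S_ring n) \<longleftrightarrow> (\<forall>m \<in> Poly_Mapping.keys p. Poly_Mapping.keys m \<subseteq> {0..n})"
  by (simp add: S_ring_def)

lemma S_zero [simp]: "0 \<in> carrier (S_ring n)"
  by (simp add: S_carrier)

lemma S_one [simp]: "1 \<in> carrier (S_ring n)"
  by (simp add: S_carrier)

lemma S_add [simp]: "\<lbrakk>p \<in> carrier (S_ring n); q \<in> carrier (S_ring n)\<rbrakk> \<Longrightarrow> p + q \<in> carrier (S_ring n)"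
  using Poly_Mapping.keys_add[of p q] by (fastforce simp: S_carrier)

lemma S_single: "Poly_Mapping.keys t \<subseteq> {0..n} \<Longrightarrow> Poly_Mapping.single t c \<in> carrier (S_ring n)"
  by (simp add: S_carrier)

lemma S_const [simp]: "const c \<in> carrier (S_ring n)"
  by (simp add: const_def S_carrier)

lemma S_Xvar [simp]: "j \<le> n \<Longrightarrow> Xvar j \<in> carrier (S_ring n)"
  by (simp add: Xvar_def S_carrier)

lemma S_Avar [simp]: "Avar \<in> carrier (S_ring n)"
  by (simp add: Avar_def)

lemma S_mult [simp]: "\<lbrakk>p \<in> carrier (S_ring n); q \<in> carrier (S_ring n)\<rbrakk> \<Longrightarrow> p * q \<in> carrier (S_ring n)"
proof -
  assume p: "p \<in> carrier (S_ring n)" and q: "q \<in> carrier (S_ring n)"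
  have "Poly_Mapping.keys m \<subseteq> {0..n}" if m: "m \<in> Poly_Mapping.keys (p * q)" for m
  proof -
    obtain a b where "m = a + b" "a \<in> Poly_Mapping.keys p" "b \<in> Poly_Mapping.keys q"
      using m Poly_Mapping.keys_mult[of p q] by blast
    moreover from this have "Poly_Mapping.keys a \<subseteq> {0..n}" "Poly_Mapping.keys b \<subseteq> {0..n}"
      using p q by (auto simp: S_carrier)
    ultimately show ?thesis using Poly_Mapping.keys_add[of a b] by blast
  qed
  then show ?thesis by (simp add: S_carrier)
qed

lemma S_uminus [simp]: "p \<in> carrier (S_ring n) \<Longrightarrow> - p \<in> carrier (S_ring n)"
  by (simp add: S_carrier in_keys_iff)

lemma S_diff [simp]: "\<lbrakk>p \<in> carrier (S_ring n); q \<in> carrier (S_ring n)\<rbrakk> \<Longrightarrow> p - q \<in> carrier (S_ring n)"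
  using S_add[of p n "- q"] by simp

lemma S_kscale [simp]: "p \<in> carrier (S_ring n) \<Longrightarrow> kscale c p \<in> carrier (S_ring n)"
  by (simp add: kscale_def)

lemma S_sum: "(\<And>i. i \<in> A \<Longrightarrow> f i \<in> carrier (S_ring n)) \<Longrightarrow> sum f A \<in> carrier (S_ring n)"
  by (induction A rule: infinite_finite_induct) auto

lemma S_cring: "cring (S_ring n)"
proof (rule cringI)
  show "abelian_group (S_ring n)"
  proof (rule abelian_groupI)
    fix x assume "x \<in> carrier (S_ring n)"
    then show "\<exists>y\<in>carrier (S_ring n). y \<oplus>\<^bsub>S_ring n\<^esub> x = \<zero>\<^bsub>S_ring n\<^esub>"
      by (intro bexI[of _ "- x"]) auto
  qed (simp_all add: algebra_simps)
  show "Group.comm_monoid (S_ring n)"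
    by (rule comm_monoidI) (simp_all add: algebra_simps)
qed (simp add: algebra_simps)

lemma S_a_inv: "p \<in> carrier (S_ring n) \<Longrightarrow> \<ominus>\<^bsub>S_ring n\<^esub> p = - p"
proof -
  assume p: "p \<in> carrier (S_ring n)"
  interpret S: cring "S_ring n" by (rule S_cring)
  show ?thesis using S.minus_equality[of "- p" p] p by simp
qed

text \<open>Negatives come from multiplication by -1 and right multiples from commutativity, so
  closure under sums and left multiples is the whole condition.\<close>

lemma S_ideal_iff:
  "ideal I (S_ring n) \<longleftrightarrow> I \<subseteq> carrier (S_ring n) \<and> 0 \<in> I \<and> (\<forall>f \<in> I. \<forall>g \<in> I. f + g \<in> I) \<and>
     (\<forall>g \<in> carrier (S_ring n). \<forall>f \<in> I. g * f \<in> I)" (is "_ \<longleftrightarrow> ?r")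
proof
  assume I: "ideal I (S_ring n)"
  note A = ideal.axioms(1)[OF I]
  show ?r
    using additive_subgroup.a_subset[OF A] additive_subgroup.zero_closed[OF A]
      additive_subgroup.a_closed[OF A] ideal.I_l_closed[OF I]
    unfolding S_ring_simps by blast
next
  assume r: ?r
  interpret S: cring "S_ring n" by (rule S_cring)
  have neg: "- f \<in> I" if "f \<in> I" for f
  proof -
    have "(- 1) * f \<in> I" using r that S_uminus[OF S_one] by blast
    then show ?thesis by simp
  qed
  show "ideal I (S_ring n)"
  proof (rule idealI)
    show "ring (S_ring n)" by (rule S.ring_axioms)
    show "subgroup I (add_monoid (S_ring n))"
    proof (rule S.add.subgroupI)
      fix f assume f: "f \<in> I"
      then have "\<ominus>\<^bsub>S_ring n\<^esub> f = - f" using r S_a_inv by blast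
      then show "\<ominus>\<^bsub>S_ring n\<^esub> f \<in> I" using neg f by simp
    qed (use r in auto)
    fix f g :: "'a mpoly" assume "f \<in> I" "g \<in> carrier (S_ring n)"
    then have "g * f \<in> I" using r by blast
    then show "g \<otimes>\<^bsub>S_ring n\<^esub> f \<in> I" "f \<otimes>\<^bsub>S_ring n\<^esub> g \<in> I"
      by (simp_all add: mult.commute)
  qed
qed

lemma S_idealD:
  assumes "ideal I (S_ring n)"
  shows "f \<in> I \<Longrightarrow> f \<in> carrier (S_ring n)" "0 \<in> I" "\<lbrakk>f \<in> I; g \<in> I\<rbrakk> \<Longrightarrow> f + g \<in> I"
    "\<lbrakk>g \<in> carrier (S_ring n); f \<in> I\<rbrakk> \<Longrightarrow> g * f \<in> I"
    "\<lbrakk>g \<in> carrier (S_ring n); f \<in> I\<rbrakk> \<Longrightarrow> f * g \<in> I"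
    "f \<in> I \<Longrightarrow> - f \<in> I" "\<lbrakk>f \<in> I; g \<in> I\<rbrakk> \<Longrightarrow> f - g \<in> I"
proof -
  note I = assms[unfolded S_ideal_iff]
  show "f \<in> I \<Longrightarrow> f \<in> carrier (S_ring n)" "0 \<in> I" "\<lbrakk>f \<in> I; g \<in> I\<rbrakk> \<Longrightarrow> f + g \<in> I"
    and m: "\<lbrakk>g \<in> carrier (S_ring n); f \<in> I\<rbrakk> \<Longrightarrow> g * f \<in> I"
    using I by blast+
  then show "\<lbrakk>g \<in> carrier (S_ring n); f \<in> I\<rbrakk> \<Longrightarrow> f * g \<in> I" by (simp add: mult.commute)
  have neg: "- f \<in> I" if "f \<in> I" for f
  proof -
    have "(- 1) * f \<in> I" using I that S_uminus[OF S_one] by blast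
    then show ?thesis by simp
  qed
  show "f \<in> I \<Longrightarrow> - f \<in> I" by (rule neg)
  show "\<lbrakk>f \<in> I; g \<in> I\<rbrakk> \<Longrightarrow> f - g \<in> I" using neg[of g] I by (metis add_uminus_conv_diff)
qed

lemma S_ideal_sum:
  assumes "ideal I (S_ring n)" and "\<And>i. i \<in> A \<Longrightarrow> f i \<in> I"
  shows "sum f A \<in> I"
  using assms(2) by (induction A rule: infinite_finite_induct) (auto intro: S_idealD(2,3)[OF assms(1)])

lemma S_set_add: "I <+>\<^bsub>S_ring n\<^esub> K = {f + g | f g. f \<in> I \<and> g \<in> K}"
  by (auto simp: set_add_defs)

text \<open>The colon ideal (I : T). Since it is an ideal, a statement that products lie in I can be
  checked on generators of a factor.\<close>

lemma S_ideal_quotient: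
  assumes I: "ideal I (S_ring n)" and T: "T \<subseteq> carrier (S_ring n)"
  shows "ideal {g \<in> carrier (S_ring n). \<forall>h \<in> T. g * h \<in> I} (S_ring n)"
  using S_idealD[OF I] T by (auto simp: S_ideal_iff distrib_right mult.assoc)

lemma poly_mapping_sum_single: "p = (\<Sum>t \<in> Poly_Mapping.keys p. Poly_Mapping.single t (Poly_Mapping.lookup p t))"
  by (rule poly_mapping_eqI)
    (auto simp: lookup_sum lookup_single when_def in_keys_iff)

text \<open>Multiplication by a monomial shifts exponents by \<open>t\<close>, so the convolution
  has at most one nonzero term.\<close>

lemma lookup_single_mult:
  fixes c :: "'k::field" and t :: "nat \<Rightarrow>\<^sub>0 nat"
  shows "Poly_Mapping.lookup (Poly_Mapping.single t c * p) (t + m) = c * Poly_Mapping.lookup p m"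
    and "\<nexists>m'. m = t + m' \<Longrightarrow> Poly_Mapping.lookup (Poly_Mapping.single t c * p) m = 0"
proof -
  have *: "Poly_Mapping.lookup (Poly_Mapping.single t c * p) k =
      c * Sum_any (\<lambda>q. Poly_Mapping.lookup p q when k = t + q)" for k
    by (simp add: lookup_mult lookup_single when_mult)
  have "(t + m = t + q) = (m = q)" for q by simp
  then show "Poly_Mapping.lookup (Poly_Mapping.single t c * p) (t + m) = c * Poly_Mapping.lookup p m"
    unfolding * by (simp only:) simp
  show "Poly_Mapping.lookup (Poly_Mapping.single t c * p) m = 0" if "\<nexists>m'. m = t + m'"
  proof -
    have "(Poly_Mapping.lookup p q when m = t + q) = 0" for q using that by (auto simp: when_def)
    then show ?thesis unfolding * by simp
  qed
qed

section \<open>Monomials, their degrees and low coefficients\<close>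

abbreviation ind :: "nat \<Rightarrow> nat \<Rightarrow>\<^sub>0 nat" where
  "ind j \<equiv> Poly_Mapping.single j (Suc 0)"

lemma Xvar_eq: "Xvar j = Poly_Mapping.single (ind j) 1"
  by (simp add: Xvar_def)

lemma ind_eq_iff [simp]: "ind p = ind q \<longleftrightarrow> p = q"
proof
  assume eq: "ind p = ind q"
  show "p = q"
    using arg_cong[OF eq, of "\<lambda>m. Poly_Mapping.lookup m q"]
    by (simp add: lookup_single when_def split: if_splits)
qed simp

text \<open>A quadratic monomial fixes its factors as an unordered pair; comparing exponents at
  \<open>i\<close> and at \<open>j\<close> suffices.\<close>

lemma ind_add_eq_iff: "ind i + ind j = ind p + ind q \<longleftrightarrow> i = p \<and> j = q \<or> i = q \<and> j = p"
proof
  assume eq: "ind i + ind j = ind p + ind q"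
  have "(Suc 0 when i = k) + (Suc 0 when j = k) = (Suc 0 when p = k) + (Suc 0 when q = k)" for k
    using arg_cong[OF eq, of "\<lambda>m. Poly_Mapping.lookup m k"] by (simp add: lookup_add lookup_single)
  from this[of i] this[of j] show "i = p \<and> j = q \<or> i = q \<and> j = p"
    by (auto simp: when_def split: if_splits)
qed (auto simp: add.commute)

lemma monom_degree_superset:
  assumes "finite A" "Poly_Mapping.keys m \<subseteq> A"
  shows "monom_degree m = (\<Sum>j\<in>A. Poly_Mapping.lookup m j)"
  unfolding monom_degree_def using assms by (intro sum.mono_neutral_left) (auto simp: in_keys_iff)

lemma monom_degree_add [simp]: "monom_degree (a + b) = monom_degree a + monom_degree b"
proof -
  let ?A = "Poly_Mapping.keys a \<union> Poly_Mapping.keys b"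
  have "Poly_Mapping.keys (a + b) \<subseteq> ?A" by (rule Poly_Mapping.keys_add)
  then show ?thesis
    by (simp add: monom_degree_superset[of ?A] lookup_add sum.distrib)
qed

lemma monom_degree_single [simp]: "monom_degree (Poly_Mapping.single j d) = d"
  by (cases "d = 0") (simp_all add: monom_degree_def)

lemma monom_degree_zero [simp]: "monom_degree 0 = 0"
  by (simp add: monom_degree_def)

lemma monom_split:
  assumes "p \<in> Poly_Mapping.keys t"
  obtains t' where "t = ind p + t'" "Poly_Mapping.keys t' \<subseteq> Poly_Mapping.keys t"
proof
  show "t = ind p + (t - ind p)"
    using assms by (intro poly_mapping_eqI) (auto simp: lookup_add lookup_minus lookup_single when_def in_keys_iff)
  show "Poly_Mapping.keys (t - ind p) \<subseteq> Poly_Mapping.keys t"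
    by (auto simp: in_keys_iff lookup_minus)
qed

lemma monom_cases:
  obtains "t = 0" | p t' where "p \<in> Poly_Mapping.keys t" "t = ind p + t'" "Poly_Mapping.keys t' \<subseteq> Poly_Mapping.keys t"
  by (metis all_not_in_conv keys_eq_empty monom_split)

lemma monom_degree_le_1:
  assumes "monom_degree t \<le> 1"
  shows "t = 0 \<or> (\<exists>j. t = ind j)"
proof (cases t rule: monom_cases)
  case (2 p t')
  then have "monom_degree t' = 0" using assms by simp
  then have "t' = 0" by (cases t' rule: monom_cases) auto
  then show ?thesis using 2(2) by auto
qed simp

text \<open>The listed monomials are the elements of the $k$-basis of $R$ other than the $A X_m$.\<close>

definition vanishes_low :: "'k::field mpoly \<Rightarrow> bool" where
  "vanishes_low f \<longleftrightarrow> (\<forall>t. monom_degree t \<le> 1 \<longrightarrow> Poly_Mapping.lookup f t = 0) \<and>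
     (\<forall>d. Poly_Mapping.lookup f (Poly_Mapping.single 0 d) = 0)"

lemma vanishes_low_zero [simp]: "vanishes_low 0"
  by (simp add: vanishes_low_def)

lemma vanishes_low_add: "\<lbrakk>vanishes_low f; vanishes_low g\<rbrakk> \<Longrightarrow> vanishes_low (f + g)"
  by (simp add: vanishes_low_def lookup_add)

lemma vanishes_low_diff: "\<lbrakk>vanishes_low f; vanishes_low g\<rbrakk> \<Longrightarrow> vanishes_low (f - g)"
  by (simp add: vanishes_low_def lookup_minus)

lemma lookup_const_mult: "Poly_Mapping.lookup (const c * f) t = c * Poly_Mapping.lookup f t"
  using lookup_single_mult(1)[of 0 c f t] by (simp add: const_def)

lemma const_mult: "const (c * d) = const c * const d"
  and const_add: "const (c + d) = const c + const d"
  and const_zero: "const 0 = 0"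
  by (simp_all add: const_def mult_single single_add)

text \<open>A quadratic monomial can only be one of the listed monomials by being A^2, which
  \<open>1 \<le> q\<close> excludes; \<open>p\<close> may be 0.\<close>

lemma vanishes_low_XX:
  assumes "1 \<le> q"
  shows "vanishes_low (Xvar p * Xvar q)"
proof -
  have XX: "Xvar p * Xvar q = Poly_Mapping.single (ind p + ind q) (1::'k::field)"
    by (simp add: Xvar_eq mult_single)
  have "ind p + ind q \<noteq> t" if "monom_degree t \<le> 1" for t
    using that by auto
  moreover have "ind p + ind q \<noteq> Poly_Mapping.single 0 d" for d
  proof
    assume eq: "ind p + ind q = Poly_Mapping.single 0 d"
    show False
      using arg_cong[OF eq, of "\<lambda>m. Poly_Mapping.lookup m q"] assms by (simp add: lookup_add lookup_single)
  qed
  ultimately show ?thesis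
    by (auto simp: XX vanishes_low_def lookup_single when_def)
qed

text \<open>Every divisor of a power of A is a power of A.\<close>

lemma single_0_split:
  assumes "Poly_Mapping.single 0 d = t + (m :: nat \<Rightarrow>\<^sub>0 nat)"
  shows "m = Poly_Mapping.single 0 (Poly_Mapping.lookup m 0)"
proof (rule poly_mapping_eqI)
  fix k
  show "Poly_Mapping.lookup m k = Poly_Mapping.lookup (Poly_Mapping.single 0 (Poly_Mapping.lookup m 0)) k"
    using arg_cong[OF assms, of "\<lambda>m. Poly_Mapping.lookup m k"]
    by (cases "k = 0") (simp_all add: lookup_add lookup_single)
qed

text \<open>A nonconstant monomial raises the degree, so coefficients of the product in degree at
  most 2 come from those of \<open>f\<close> in degree at most 1. This is why functionals reading
  quadratic coefficients vanish on such multiples of \<open>f\<close>.\<close>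

lemma vanishes_low_mult_degree_2:
  assumes f: "vanishes_low f" and "t \<noteq> 0" "monom_degree m \<le> 2"
  shows "Poly_Mapping.lookup (Poly_Mapping.single t c * f) m = 0"
proof (cases "\<exists>m'. m = t + m'")
  case True
  then obtain m' where m': "m = t + m'" by blast
  have "monom_degree t \<noteq> 0" using \<open>t \<noteq> 0\<close> by (cases t rule: monom_cases) auto
  then have "monom_degree m' \<le> 1" using assms(3) m' by simp
  then show ?thesis using f by (simp add: m' lookup_single_mult(1) vanishes_low_def)
qed (simp add: lookup_single_mult(2))

lemma vanishes_low_mult:
  assumes f: "vanishes_low f"
  shows "vanishes_low (Poly_Mapping.single t c * f)"
proof (cases "t = 0")
  case True
  then show ?thesis using f lookup_const_mult[of c f] by (simp add: vanishes_low_def const_def)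
next
  case False
  have "Poly_Mapping.lookup (Poly_Mapping.single t c * f) (Poly_Mapping.single 0 d) = 0" for d
  proof (cases "\<exists>m. Poly_Mapping.single 0 d = t + m")
    case True
    then obtain m where m: "Poly_Mapping.single 0 d = t + m" by blast
    have "Poly_Mapping.lookup f m = 0"
      using f single_0_split[OF m] unfolding vanishes_low_def by metis
    then show ?thesis by (simp add: m lookup_single_mult(1))
  qed (simp add: lookup_single_mult(2))
  then show ?thesis
    using vanishes_low_mult_degree_2[OF f False] by (auto simp: vanishes_low_def)
qed

lemma vanishes_low_sum: "(\<And>i. i \<in> A \<Longrightarrow> vanishes_low (f i)) \<Longrightarrow> vanishes_low (sum f A)"
  by (induction A rule: infinite_finite_induct) (auto intro: vanishes_low_add)

section \<open>A normal form modulo $J$\<close>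

text \<open>Conditions (1) to (3) of the context. \<open>l_less\<close> puts X_n into V, so that A
  X_n can serve as test element for the constant term.\<close>

locale linear_matrix =
  fixes n l :: nat and \<Delta> :: "nat \<Rightarrow> nat \<Rightarrow> 'k::field mpoly"
  assumes l_less: "l < n"
    and \<Delta>_sym: "\<And>i j. \<lbrakk>i \<in> {1..l}; j \<in> {1..l}\<rbrakk> \<Longrightarrow> \<Delta> i j = \<Delta> j i"
    and \<Delta>_span: "kvs.span (Xvar ` {l+1..n}) = kvs.span {\<Delta> i j | i j. i \<in> {1..l} \<and> j \<in> {1..n}}"
    and \<Delta>_ker: "\<And>c. (\<forall>i \<in> {1..l}. (\<Sum>j = 1..n. \<Delta> i j * const (c j)) = 0) \<Longrightarrow> \<forall>j \<in> {1..n}. c j = 0"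
begin

lemma l_le: "l \<le> n"
  using l_less by simp

abbreviation "S \<equiv> S_ring n :: 'k mpoly ring"
abbreviation "J \<equiv> J_ideal n l \<Delta>"
abbreviation "V \<equiv> kvs.span (Xvar ` {l+1..n}) :: 'k mpoly set"

lemma \<Delta>_V: "\<lbrakk>i \<in> {1..l}; j \<in> {1..n}\<rbrakk> \<Longrightarrow> \<Delta> i j \<in> V"
  unfolding \<Delta>_span by (rule kvs.span_base) blast

text \<open>Both sides are linear in \<open>v\<close>, so it is enough to compare them on the
  variables that span V.\<close>

lemma V_expand:
  assumes "v \<in> V"
  shows "v = (\<Sum>m = l+1..n. const (Poly_Mapping.lookup v (ind m)) * Xvar m)"
  using assms
proof (induction rule: kvs.span_induct)
  case base
  show ?case
    by (rule kvs.subspaceI)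
      (simp_all add: lookup_add kscale_def lookup_const_mult const_mult const_add const_zero
        distrib_right sum.distrib mult.assoc flip: sum_distrib_left)
next
  case (step x)
  then obtain p where p: "p \<in> {l+1..n}" "x = Xvar p" by blast
  have "(\<Sum>m = l+1..n. const (Poly_Mapping.lookup x (ind m)) * Xvar m) =
      (\<Sum>m = l+1..n. if m = p then Xvar p else 0)"
    by (intro sum.cong) (auto simp: p Xvar_eq lookup_single when_def const_def mult_single)
  then show ?case using p by simp
qed

lemma V_S: "v \<in> V \<Longrightarrow> v \<in> carrier S"
  by (subst V_expand) (auto intro!: S_sum S_mult)

lemma \<Delta>_S: "\<lbrakk>i \<in> {1..l}; j \<in> {1..n}\<rbrakk> \<Longrightarrow> \<Delta> i j \<in> carrier S"
  by (intro V_S \<Delta>_V)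

lemma V_eq_0: "\<lbrakk>v \<in> V; \<And>m. m \<in> {l+1..n} \<Longrightarrow> Poly_Mapping.lookup v (ind m) = 0\<rbrakk> \<Longrightarrow> v = 0"
  using V_expand[of v] by (simp add: const_def)

abbreviation "gens1 \<equiv> {Avar * Xvar i | i. i \<in> {1..l}} :: 'k mpoly set"
abbreviation "gens2 \<equiv> Xvar ` {l+1..n} :: 'k mpoly set"
abbreviation "gens3 \<equiv> {Xvar i * Xvar j - Avar * \<Delta> i j | i j. i \<in> {1..l} \<and> j \<in> {1..n}}"

lemma gens_S: "gens1 \<subseteq> carrier S" "gens2 \<subseteq> carrier S" "gens3 \<subseteq> carrier S"
  using l_le \<Delta>_S by auto

lemma J_is_ideal: "ideal J S"
  and gens1_J: "gens1 \<subseteq> J"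
  and gens2_J: "\<lbrakk>p \<in> gens2; q \<in> gens2\<rbrakk> \<Longrightarrow> p * q \<in> J"
  and gens3_J: "gens3 \<subseteq> J"
proof -
  interpret S: cring S by (rule S_cring)
  let ?I1 = "Idl\<^bsub>S\<^esub> gens1" and ?I2 = "Idl\<^bsub>S\<^esub> gens2" and ?I3 = "Idl\<^bsub>S\<^esub> gens3"
  let ?P = "ideal_prod S ?I2 ?I2"
  have I1: "ideal ?I1 S" and I2: "ideal ?I2 S" and I3: "ideal ?I3 S"
    using gens_S by (intro S.genideal_ideal; simp)+
  have P: "ideal ?P S" by (rule S.ideal_prod_is_ideal[OF I2 I2])
  have I1P: "ideal (?I1 <+>\<^bsub>S\<^esub> ?P) S" by (rule S.add_ideals[OF I1 P])
  show "ideal J S" unfolding J_ideal_def by (rule S.add_ideals[OF I1P I3])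
  have incl: "A \<subseteq> A <+>\<^bsub>S\<^esub> B" "B \<subseteq> A <+>\<^bsub>S\<^esub> B" if "ideal A S" "ideal B S" for A B
    using S_idealD(2)[OF that(1)] S_idealD(2)[OF that(2)] by (force simp: S_set_add)+
  have "gens1 \<subseteq> ?I1" "gens2 \<subseteq> ?I2" "gens3 \<subseteq> ?I3" by (intro S.genideal_self gens_S)+
  note incl1 = incl[OF I1 P] and incl2 = incl[OF I1P I3]
  show "gens1 \<subseteq> J" "gens3 \<subseteq> J"
    using \<open>gens1 \<subseteq> ?I1\<close> \<open>gens3 \<subseteq> ?I3\<close> incl1 incl2 unfolding J_ideal_def by blast+
  assume "p \<in> gens2" "q \<in> gens2"
  then have "p \<otimes>\<^bsub>S\<^esub> q \<in> ?P"
    using \<open>gens2 \<subseteq> ?I2\<close> by (intro ideal_prod.prod) blast+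
  then show "p * q \<in> J"
    using incl1 incl2 unfolding J_ideal_def by auto
qed

text \<open>The ideal product involves arbitrary elements of the ideal of the X_m with m > l,
  whereas \<open>g2\<close> speaks of its generators only; colon ideals extend \<open>g2\<close> to
  one factor at a time.\<close>

lemma J_least:
  assumes I: "ideal I S" and g1: "gens1 \<subseteq> I" and g3: "gens3 \<subseteq> I"
    and g2: "\<And>p q. \<lbrakk>p \<in> gens2; q \<in> gens2\<rbrakk> \<Longrightarrow> p * q \<in> I"
  shows "J \<subseteq> I"
proof -
  interpret S: cring S by (rule S_cring)
  let ?I1 = "Idl\<^bsub>S\<^esub> gens1" and ?I2 = "Idl\<^bsub>S\<^esub> gens2" and ?I3 = "Idl\<^bsub>S\<^esub> gens3"
  have I2: "ideal ?I2 S" using gens_S by (intro S.genideal_ideal)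
  have sum: "A <+>\<^bsub>S\<^esub> B \<subseteq> I" if "A \<subseteq> I" "B \<subseteq> I" for A B
    using that S_idealD(3)[OF I] by (auto simp: S_set_add)
  have "?I2 \<subseteq> {g \<in> carrier S. \<forall>h\<in>gens2. g * h \<in> I}"
    using gens_S g2 by (intro S.genideal_minimal[OF S_ideal_quotient[OF I gens_S(2)]]) blast
  then have "gens2 \<subseteq> {g \<in> carrier S. \<forall>h\<in>?I2. g * h \<in> I}"
    using gens_S by (fastforce simp: mult.commute)
  \<comment> \<open>Second pass: the generators already multiply all of \<open>?I2\<close> into
    \<open>I\<close>, so minimality of \<open>?I2\<close> applies to the other factor.\<close>
  then have *: "?I2 \<subseteq> {g \<in> carrier S. \<forall>h\<in>?I2. g * h \<in> I}"
    using S_idealD(1)[OF I2] by (intro S.genideal_minimal[OF S_ideal_quotient[OF I]]) blast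
  have "x \<in> I" if "x \<in> ideal_prod S ?I2 ?I2" for x
    using that
  proof (induction rule: ideal_prod.induct)
    case (prod i j)
    then show ?case using * by auto
  next
    case (sum s1 s2)
    then show ?case using S_idealD(3)[OF I] by simp
  qed
  then have "ideal_prod S ?I2 ?I2 \<subseteq> I" by blast
  moreover have "?I1 \<subseteq> I" "?I3 \<subseteq> I" by (intro S.genideal_minimal I g1 g3)+
  ultimately show ?thesis unfolding J_ideal_def by (intro sum)
qed

text \<open>
  The coefficient of the basis element $A X_m$ of $R$: a monomial $X_i X_j$ with $i \le l$ contributes
  through $X_i X_j = A \Delta_{i,j}$, where $j \ge i$ counts each unordered pair once.
\<close>

definition lam :: "nat \<Rightarrow> 'k mpoly \<Rightarrow> 'k" where
  "lam m f = Poly_Mapping.lookup f (ind 0 + ind m) +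
     (\<Sum>i = 1..l. \<Sum>j = i..n. Poly_Mapping.lookup f (ind i + ind j) * Poly_Mapping.lookup (\<Delta> i j) (ind m))"

lemma lam_zero [simp]: "lam m 0 = 0"
  by (simp add: lam_def)

lemma lam_add: "lam m (f + g) = lam m f + lam m g"
  by (simp add: lam_def lookup_add distrib_right sum.distrib)

lemma lam_diff: "lam m (f - g) = lam m f - lam m g"
  by (simp add: lam_def lookup_minus left_diff_distrib sum_subtractf)

lemma lam_const_mult: "lam m (const c * f) = c * lam m f"
  by (simp add: lam_def lookup_const_mult distrib_left sum_distrib_left mult.assoc)

lemma lam_eq_0: "(\<And>i j. Poly_Mapping.lookup f (ind i + ind j) = 0) \<Longrightarrow> lam m f = 0"
  by (simp add: lam_def)

text \<open>The correction sum reads only monomials without A, so only the coefficient of A X_m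
  itself contributes.\<close>

lemma lam_A_mult: "lam m (Avar * v) = Poly_Mapping.lookup v (ind m)"
proof -
  have 0: "Poly_Mapping.lookup (Avar * v) (ind i + ind j) = 0" if "1 \<le> i" "1 \<le> j" for i j
    unfolding Avar_def Xvar_eq
  proof (rule lookup_single_mult(2), safe)
    fix m' assume eq: "ind i + ind j = ind 0 + m'"
    show False
      using arg_cong[OF eq, of "\<lambda>m. Poly_Mapping.lookup m 0"] that by (simp add: lookup_add lookup_single)
  qed
  have "Poly_Mapping.lookup (Avar * v) (ind 0 + ind m) = Poly_Mapping.lookup v (ind m)"
    unfolding Avar_def Xvar_eq lookup_single_mult(1) by simp
  moreover have "(\<Sum>i = 1..l. \<Sum>j = i..n. Poly_Mapping.lookup (Avar * v) (ind i + ind j) * Poly_Mapping.lookup (\<Delta> i j) (ind m)) = 0"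
    by (intro sum.neutral ballI) (auto simp: 0)
  ultimately show ?thesis by (simp add: lam_def)
qed

lemma lookup_XX:
  "Poly_Mapping.lookup (Xvar p * Xvar q) (ind i + ind j) =
    (if i = p \<and> j = q \<or> i = q \<and> j = p then 1 else 0 :: 'k)"
proof -
  have "Xvar p * Xvar q = Poly_Mapping.single (ind p + ind q) (1::'k)"
    by (simp add: Xvar_eq mult_single)
  then show ?thesis using ind_add_eq_iff[of p q i j] by (auto simp: lookup_single when_def)
qed

lemma lam_XX_le:
  assumes p: "p \<in> {1..l}" and q: "q \<in> {p..n}"
  shows "lam m (Xvar p * Xvar q) = Poly_Mapping.lookup (\<Delta> p q) (ind m)"
proof -
  have "(\<Sum>i = 1..l. \<Sum>j = i..n. Poly_Mapping.lookup (Xvar p * Xvar q) (ind i + ind j) * Poly_Mapping.lookup (\<Delta> i j) (ind m))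
    = (\<Sum>i = 1..l. if i = p then (\<Sum>j = i..n. if j = q then Poly_Mapping.lookup (\<Delta> i j) (ind m) else 0) else 0)"
  proof (intro sum.cong refl)
    fix i assume "i \<in> {1..l}"
    have "(\<Sum>j = i..n. Poly_Mapping.lookup (Xvar p * Xvar q) (ind i + ind j) * Poly_Mapping.lookup (\<Delta> i j) (ind m))
      = (\<Sum>j = i..n. if i = p \<and> j = q then Poly_Mapping.lookup (\<Delta> i j) (ind m) else 0)"
      unfolding lookup_XX using q by (intro sum.cong refl) auto
    then show "(\<Sum>j = i..n. Poly_Mapping.lookup (Xvar p * Xvar q) (ind i + ind j) * Poly_Mapping.lookup (\<Delta> i j) (ind m))
      = (if i = p then \<Sum>j = i..n. if j = q then Poly_Mapping.lookup (\<Delta> i j) (ind m) else 0 else 0)"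
      by simp
  qed
  also have "\<dots> = Poly_Mapping.lookup (\<Delta> p q) (ind m)" using p q by simp
  finally show ?thesis using p q unfolding lam_def lookup_XX by simp
qed

text \<open>The point where symmetry of Delta is needed: for \<open>p > q\<close> the pair is
  counted in \<open>lam\<close> as (q, p), while the generator of J carries the entry at (p,
  q).\<close>

lemma lam_XX:
  assumes p: "p \<in> {1..l}" and q: "q \<in> {1..n}"
  shows "lam m (Xvar p * Xvar q) = Poly_Mapping.lookup (\<Delta> p q) (ind m)"
proof (cases "p \<le> q")
  case True
  then show ?thesis using lam_XX_le[of p q m] assms by simp
next
  case False
  then show ?thesis
    using lam_XX_le[of q p m] assms l_le \<Delta>_sym[of p q] by (simp add: mult.commute)
qed

text \<open>The third premise merges two families of generators: A X_q with q <= l, and X_p X_q with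
  both indices above l.\<close>

lemma lam_XX_0:
  assumes "p \<in> insert 0 {l+1..n}" "q \<in> {1..n}" "p = 0 \<longleftrightarrow> q \<le> l" "m \<in> {l+1..n}"
  shows "lam m (Xvar p * Xvar q) = 0"
proof -
  have "(\<Sum>i = 1..l. \<Sum>j = i..n. Poly_Mapping.lookup (Xvar p * Xvar q) (ind i + ind j) * Poly_Mapping.lookup (\<Delta> i j) (ind m)) = 0"
    unfolding lookup_XX using assms by (intro sum.neutral ballI) auto
  moreover have "Poly_Mapping.lookup (Xvar p * Xvar q) (ind 0 + ind m) = (0::'k)"
    unfolding lookup_XX using assms by auto
  ultimately show ?thesis unfolding lam_def by simp
qed

definition JN :: "'k mpoly set" where
  "JN = {f \<in> carrier S. vanishes_low f \<and> (\<forall>m \<in> {l+1..n}. lam m f = 0)}"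

text \<open>By additivity only monomial multiples matter. A constant rescales all functionals; a
  nonconstant monomial sends quadratic coefficients to those of degree at most 1 in
  \<open>f\<close>, which are zero.\<close>

lemma JN_ideal: "ideal JN S"
proof -
  have single: "Poly_Mapping.single t c * f \<in> JN" if "Poly_Mapping.keys t \<subseteq> {0..n}" "f \<in> JN" for t c f
  proof -
    have f: "vanishes_low f" "\<forall>m \<in> {l+1..n}. lam m f = 0" "f \<in> carrier S"
      using that(2) by (auto simp: JN_def)
    have "lam m (Poly_Mapping.single t c * f) = 0" if m: "m \<in> {l+1..n}" for m
    proof (cases "t = 0")
      case True
      then show ?thesis using lam_const_mult[of m c f] f m by (simp add: const_def)
    next
      case False
      show ?thesis by (rule lam_eq_0) (rule vanishes_low_mult_degree_2[OF f(1) False], simp)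
    qed
    then show ?thesis using vanishes_low_mult[OF f(1)] f(3) that(1) by (simp add: JN_def S_single)
  qed
  have add: "f + g \<in> JN" if "f \<in> JN" "g \<in> JN" for f g
    using that by (simp add: JN_def lam_add vanishes_low_add)
  have zero: "0 \<in> JN" by (simp add: JN_def)
  have sum: "sum h A \<in> JN" if "\<And>i. i \<in> A \<Longrightarrow> h i \<in> JN" for h :: "(nat \<Rightarrow>\<^sub>0 nat) \<Rightarrow> 'k mpoly" and A
    using that by (induction A rule: infinite_finite_induct) (auto intro: add zero)
  have "g * f \<in> JN" if "g \<in> carrier S" "f \<in> JN" for f g
  proof -
    have "g * f = (\<Sum>t \<in> Poly_Mapping.keys g. Poly_Mapping.single t (Poly_Mapping.lookup g t) * f)"
      by (subst poly_mapping_sum_single[of g]) (simp only: sum_distrib_right)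
    also have "\<dots> \<in> JN" using that by (intro sum single) (auto simp: S_carrier)
    finally show ?thesis .
  qed
  then show ?thesis
    unfolding S_ideal_iff using add zero by (auto simp: JN_def)
qed

lemma vanishes_low_AV: "v \<in> V \<Longrightarrow> vanishes_low (Avar * v)"
proof -
  assume "v \<in> V"
  then have "Avar * v = (\<Sum>m = l+1..n. Poly_Mapping.single 0 (Poly_Mapping.lookup v (ind m)) * (Xvar 0 * Xvar m))"
    by (subst V_expand) (simp_all add: sum_distrib_left mult_ac Avar_def const_def)
  moreover have "vanishes_low \<dots>"
    by (intro vanishes_low_sum vanishes_low_mult vanishes_low_XX) auto
  ultimately show ?thesis by simp
qed

text \<open>On X_i X_j and on A Delta_ij the functional \<open>lam m\<close> has the same value, the
  coefficient of X_m in Delta_ij; this is what its correction sum is built for.\<close>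

lemma J_sub_JN: "J \<subseteq> JN"
proof (rule J_least[OF JN_ideal])
  show "gens1 \<subseteq> JN"
    using l_le lam_XX_0[of 0] by (auto simp: JN_def Avar_def vanishes_low_XX)
  show "gens3 \<subseteq> JN"
  proof safe
    fix i j assume i: "i \<in> {1..l}" and j: "j \<in> {1..n}"
    have "vanishes_low (Xvar i * Xvar j - Avar * \<Delta> i j)"
      using j by (intro vanishes_low_diff vanishes_low_XX vanishes_low_AV \<Delta>_V i j) simp
    moreover have "lam m (Xvar i * Xvar j - Avar * \<Delta> i j) = 0" for m
      by (simp add: lam_diff lam_XX[OF i j] lam_A_mult)
    ultimately show "Xvar i * Xvar j - Avar * \<Delta> i j \<in> JN"
      using i j l_le \<Delta>_S[OF i j] by (simp add: JN_def)
  qed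
  fix p q :: "'k mpoly" assume "p \<in> gens2" "q \<in> gens2"
  then show "p * q \<in> JN"
    using lam_XX_0 by (auto simp: JN_def intro!: vanishes_low_XX)
qed

end

section \<open>Reduction of monomials modulo J\<close>

lemma S_ideal_subspace:
  assumes "ideal I (S_ring n)"
  shows "kvs.subspace I"
  using S_idealD[OF assms] by (auto intro!: kvs.subspaceI simp: kscale_def)

lemma monom_no_nonzero_key:
  assumes "Poly_Mapping.keys t \<subseteq> {0}"
  shows "t = Poly_Mapping.single 0 (Poly_Mapping.lookup t 0)"
proof (rule poly_mapping_eqI)
  fix k show "Poly_Mapping.lookup t k = Poly_Mapping.lookup (Poly_Mapping.single 0 (Poly_Mapping.lookup t 0)) k"
    using assms by (cases "k = 0") (auto simp: lookup_single in_keys_iff subset_iff)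
qed

context linear_matrix
begin

lemmas J_D = S_idealD[OF J_is_ideal]

lemma J_AX: "i \<in> {1..l} \<Longrightarrow> Avar * Xvar i \<in> J"
  using gens1_J by blast

lemma J_rel: "\<lbrakk>i \<in> {1..l}; j \<in> {1..n}\<rbrakk> \<Longrightarrow> Xvar i * Xvar j - Avar * \<Delta> i j \<in> J"
  using gens3_J by blast

text \<open>Being multiplied into J by \<open>u\<close> is a linear condition, so for V it can be
  tested on whichever spanning set is convenient.\<close>

lemma S_annihilated_subspace: "u \<in> carrier S \<Longrightarrow> kvs.subspace {v \<in> carrier S. u * v \<in> J}"
  using S_ideal_subspace[OF S_ideal_quotient[OF J_is_ideal, of "{u}"]] by (simp add: mult.commute)

text \<open>Tested on the entries of Delta: computing A X_i X_j both from A X_i in J and from the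
  relation for X_i X_j shows that A^2 Delta_ij lies in J.\<close>

lemma J_AAV: "v \<in> V \<Longrightarrow> Avar * Avar * v \<in> J"
proof -
  have "{\<Delta> i j | i j. i \<in> {1..l} \<and> j \<in> {1..n}} \<subseteq> {v \<in> carrier S. Avar * Avar * v \<in> J}"
  proof safe
    fix i j assume i: "i \<in> {1..l}" and j: "j \<in> {1..n}"
    show "\<Delta> i j \<in> carrier S" by (rule \<Delta>_S[OF i j])
    have "Avar * Avar * \<Delta> i j = (Avar * Xvar i) * Xvar j - Avar * (Xvar i * Xvar j - Avar * \<Delta> i j)"
      by (simp add: algebra_simps)
    also have "\<dots> \<in> J" using j by (intro J_D(4,5,7) J_AX J_rel i j) simp_all
    finally show "Avar * Avar * \<Delta> i j \<in> J" .
  qed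
  then have "V \<subseteq> {v \<in> carrier S. Avar * Avar * v \<in> J}"
    unfolding \<Delta>_span by (rule kvs.span_minimal) (intro S_annihilated_subspace S_mult S_Avar)
  then show "v \<in> V \<Longrightarrow> Avar * Avar * v \<in> J" by blast
qed

lemma J_VX:
  assumes "v \<in> V" "r \<in> {l+1..n}"
  shows "Xvar r * v \<in> J"
proof -
  have "gens2 \<subseteq> {v \<in> carrier S. Xvar r * v \<in> J}"
    using gens2_J[of "Xvar r"] assms(2) by auto
  then have "V \<subseteq> {v \<in> carrier S. Xvar r * v \<in> J}"
    using assms(2) by (intro kvs.span_minimal S_annihilated_subspace) simp_all
  then show ?thesis using assms(1) by blast
qed

text \<open>Three reasons, by the kind of variable: A^2 V lies in J, A X_r lies in J for r <= l, and
  V X_r lies in J for r > l.\<close>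

lemma J_AVX:
  assumes v: "v \<in> V" and "r \<le> n"
  shows "Avar * v * Xvar r \<in> J"
proof -
  consider "r = 0" | "r \<in> {1..l}" | "r \<in> {l+1..n}" using assms by fastforce
  then show ?thesis
  proof cases
    case 1
    then show ?thesis using J_AAV[OF v] by (simp add: Avar_def mult_ac)
  next
    case 2
    then show ?thesis using J_D(5)[OF V_S[OF v] J_AX[OF 2]] by (simp add: mult_ac)
  next
    case 3
    then show ?thesis using J_D(4)[OF S_Avar J_VX[OF v 3]] by (simp add: mult_ac)
  qed
qed

lemma XX_reduce:
  assumes "p \<in> {1..n}" "q \<le> n"
  obtains v where "v \<in> V" "Xvar p * Xvar q - Avar * v \<in> J"
proof -
  consider "q = 0" "p \<in> {1..l}" | "q = 0" "p \<in> {l+1..n}" | "p \<in> {1..l}" "q \<in> {1..n}"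
    | "p \<in> {1..n}" "q \<in> {1..l}" | "p \<in> {l+1..n}" "q \<in> {l+1..n}"
    using assms by fastforce
  then show thesis
  proof cases
    case 1
    then show ?thesis using that[OF kvs.span_zero] J_AX[of p] by (simp add: Avar_def mult.commute)
  next
    case 2
    then show ?thesis using that[of "Xvar p"] kvs.span_base[of "Xvar p" gens2] J_D(2)
      by (simp add: Avar_def mult.commute)
  next
    case 3
    then show ?thesis using that[of "\<Delta> p q"] \<Delta>_V J_rel by blast
  next
    case 4
    then show ?thesis using that[of "\<Delta> q p"] \<Delta>_V[of q p] J_rel[of q p] by (simp add: mult.commute)
  next
    case 5
    then show ?thesis using that[OF kvs.span_zero] gens2_J[of "Xvar p" "Xvar q"] by simp
  qed
qed

text \<open>Such a monomial contains a product of some X_p, p >= 1, with another variable, and this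
  product reduces into A V. In degree 2 that is the result; in higher degree a further variable
  annihilates it.\<close>

lemma single_reduce:
  assumes t: "Poly_Mapping.keys t \<subseteq> {0..n}" and low: "\<not> monom_degree t \<le> 1" "\<And>d. t \<noteq> Poly_Mapping.single 0 d"
  obtains v where "v \<in> V" "Poly_Mapping.single t c - Avar * v \<in> J"
proof -
  have "\<not> Poly_Mapping.keys t \<subseteq> {0}" using monom_no_nonzero_key[of t] low(2) by blast
  then obtain p where p: "p \<in> Poly_Mapping.keys t" "p \<noteq> 0" by blast
  obtain t' where t': "t = ind p + t'" "Poly_Mapping.keys t' \<subseteq> Poly_Mapping.keys t"
    using monom_split[OF p(1)] .
  have "t' \<noteq> 0" using low(1) t' by auto
  then obtain q t'' where q: "q \<in> Poly_Mapping.keys t'" "t' = ind q + t''" "Poly_Mapping.keys t'' \<subseteq> Poly_Mapping.keys t'"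
    by (cases t' rule: monom_cases) auto
  have pq: "p \<in> {1..n}" "q \<le> n" using p q t t' by force+
  obtain v where v: "v \<in> V" "Xvar p * Xvar q - Avar * v \<in> J" using XX_reduce[OF pq] .
  show thesis
  proof (cases t'' rule: monom_cases)
    case 1
    then have "Poly_Mapping.single t c = const c * (Xvar p * Xvar q)"
      by (simp add: t' q const_def Xvar_eq mult_single)
    then have "Poly_Mapping.single t c - Avar * (const c * v) = const c * (Xvar p * Xvar q - Avar * v)"
      by (simp add: algebra_simps)
    moreover have "\<dots> \<in> J" by (intro J_D(4) v S_const)
    moreover have "const c * v \<in> V" using kvs.span_scale[OF v(1), of c] by (simp add: kscale_def)
    ultimately show thesis using that by metis
  next
    case (2 r s)
    have "Poly_Mapping.keys t'' \<subseteq> {0..n}" using q(3) t'(2) t by blast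
    then have rn: "r \<le> n" and s: "Poly_Mapping.keys s \<subseteq> {0..n}" using 2(1,3) by auto
    \<comment> \<open>A third variable X_r is present: it kills A v modulo J, so the whole monomial
      lies in J and zero serves as the element of V.\<close>
    have "Poly_Mapping.single t c = Poly_Mapping.single s c *
        ((Xvar p * Xvar q - Avar * v) * Xvar r + Avar * v * Xvar r)"
      by (simp add: t' q 2 Xvar_eq mult_single algebra_simps)
    also have "\<dots> \<in> J" using rn by (intro J_D(3,4,5) v J_AVX S_single s) auto
    finally show thesis using that[OF kvs.span_zero] by simp
  qed
qed

lemma lam_sum: "lam m (sum f A) = (\<Sum>i\<in>A. lam m (f i))"
  by (induction A rule: infinite_finite_induct) (auto simp: lam_add)

text \<open>Termwise reduction replaces \<open>f\<close> by A w with w in V. The difference lies in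
  J, hence in \<open>JN\<close>, so every \<open>lam m\<close> vanishes on A w; these values are the
  coordinates of w.\<close>

lemma JN_sub_J: "JN \<subseteq> J"
proof
  fix f assume f: "f \<in> JN"
  then have fS: "f \<in> carrier S" and flow: "vanishes_low f" and flam: "\<And>m. m \<in> {l+1..n} \<Longrightarrow> lam m f = 0"
    by (auto simp: JN_def)
  let ?s = "\<lambda>t. Poly_Mapping.single t (Poly_Mapping.lookup f t)"
  have "\<exists>v. v \<in> V \<and> ?s t - Avar * v \<in> J" if t: "t \<in> Poly_Mapping.keys f" for t
  proof -
    have "Poly_Mapping.keys t \<subseteq> {0..n}" using fS t by (simp add: S_carrier)
    moreover have "\<not> monom_degree t \<le> 1" "\<And>d. t \<noteq> Poly_Mapping.single 0 d"
      using flow t by (auto simp: vanishes_low_def in_keys_iff)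
    ultimately show ?thesis using single_reduce[of t] by metis
  qed
  then obtain v where v: "\<And>t. t \<in> Poly_Mapping.keys f \<Longrightarrow> v t \<in> V \<and> ?s t - Avar * v t \<in> J"
    by metis
  define w where "w = sum v (Poly_Mapping.keys f)"
  have w: "w \<in> V" unfolding w_def using v by (intro kvs.span_sum) blast
  have "f - Avar * w = (\<Sum>t \<in> Poly_Mapping.keys f. ?s t - Avar * v t)"
    by (subst poly_mapping_sum_single[of f]) (simp only: sum_subtractf sum_distrib_left w_def)
  also have "\<dots> \<in> J" using v by (intro S_ideal_sum[OF J_is_ideal]) blast
  finally have fw: "f - Avar * w \<in> J" .
  then have "f - Avar * w \<in> JN" using J_sub_JN by blast
  then have "Poly_Mapping.lookup w (ind m) = 0" if "m \<in> {l+1..n}" for m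
    using flam[OF that] that by (auto simp: JN_def lam_diff lam_A_mult)
  then have "w = 0" by (intro V_eq_0[OF w])
  then show "f \<in> J" using fw by simp
qed

lemma J_eq: "J = JN"
  using J_sub_JN JN_sub_J by blast

lemma lam_J: "\<lbrakk>f \<in> J; m \<in> {l+1..n}\<rbrakk> \<Longrightarrow> lam m f = 0"
  by (simp add: J_eq JN_def)

text \<open>The preimage of $(a)$ in $S$.\<close>

definition AJ :: "'k mpoly set" where
  "AJ = {f \<in> carrier S. \<exists>h \<in> carrier S. f - Avar * h \<in> J}"

lemma AJ_I: "\<lbrakk>f \<in> carrier S; h \<in> carrier S; f - Avar * h \<in> J\<rbrakk> \<Longrightarrow> f \<in> AJ"
  by (auto simp: AJ_def)

lemma AJ_add: "\<lbrakk>f \<in> AJ; g \<in> AJ\<rbrakk> \<Longrightarrow> f + g \<in> AJ"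
proof -
  assume "f \<in> AJ" "g \<in> AJ"
  then obtain h h' where h: "f \<in> carrier S" "g \<in> carrier S" "h \<in> carrier S" "h' \<in> carrier S"
    "f - Avar * h \<in> J" "g - Avar * h' \<in> J" by (auto simp: AJ_def)
  have "f + g - Avar * (h + h') = (f - Avar * h) + (g - Avar * h')" by (simp add: algebra_simps)
  also have "\<dots> \<in> J" by (intro J_D(3) h)
  finally show ?thesis using h by (intro AJ_I[of _ "h + h'"]) simp_all
qed

lemma AJ_zero: "0 \<in> AJ"
  using AJ_I[of 0 0] J_D(2) by simp

lemma AJ_sum: "(\<And>i. i \<in> A \<Longrightarrow> f i \<in> AJ) \<Longrightarrow> sum f A \<in> AJ"
  by (induction A rule: infinite_finite_induct) (auto intro: AJ_add AJ_zero)

text \<open>Monomials divisible by A are multiples of A outright; the others that remain have degree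
  at least 2 and reduce into A V.\<close>

lemma mem_AJ:
  assumes f: "f \<in> carrier S" and f0: "Poly_Mapping.lookup f 0 = 0"
    and f1: "\<And>j. j \<in> {1..n} \<Longrightarrow> Poly_Mapping.lookup f (ind j) = 0"
  shows "f \<in> AJ"
proof -
  have "Poly_Mapping.single t (Poly_Mapping.lookup f t) \<in> AJ" if t: "t \<in> Poly_Mapping.keys f" for t
  proof -
    have tS: "Poly_Mapping.keys t \<subseteq> {0..n}" using f t by (simp add: S_carrier)
    let ?s = "Poly_Mapping.single t (Poly_Mapping.lookup f t)"
    show ?thesis
    proof (cases "0 \<in> Poly_Mapping.keys t")
      case True
      then obtain t' where t': "t = ind 0 + t'" "Poly_Mapping.keys t' \<subseteq> Poly_Mapping.keys t"
        by (rule monom_split)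
      have "?s = Avar * Poly_Mapping.single t' (Poly_Mapping.lookup f t)"
        by (subst t'(1)) (simp add: Avar_def Xvar_eq mult_single)
      then show ?thesis
        using t' tS J_D(2)
        by (intro AJ_I[of _ "Poly_Mapping.single t' (Poly_Mapping.lookup f t)"] S_single) auto
    next
      case False
      have "t \<noteq> 0" using t f0 by (auto simp: in_keys_iff)
      have "t \<noteq> Poly_Mapping.single 0 d" for d
        using False \<open>t \<noteq> 0\<close> by (cases "d = 0") auto
      moreover have "\<not> monom_degree t \<le> 1"
      proof
        assume "monom_degree t \<le> 1"
        then obtain j where j: "t = ind j" using monom_degree_le_1 \<open>t \<noteq> 0\<close> by blast
        then have "j \<in> {1..n}" using False tS by (cases "j = 0") auto
        then show False using f1 t j by (auto simp: in_keys_iff)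
      qed
      ultimately obtain v where "v \<in> V" "?s - Avar * v \<in> J"
        using single_reduce[OF tS] by metis
      then show ?thesis using tS by (intro AJ_I[of _ v] S_single V_S)
    qed
  qed
  then show ?thesis by (subst poly_mapping_sum_single[of f]) (rule AJ_sum)
qed

text \<open>The subtracted part carries exactly the coefficients that \<open>mem_AJ\<close> requires
  to vanish. It serves both the double colon ideal and the finite dimension of R/(a).\<close>

lemma linear_part_mod_AJ:
  assumes f: "f \<in> carrier S"
  shows "f - (const (Poly_Mapping.lookup f 0) + (\<Sum>j = 1..n. const (Poly_Mapping.lookup f (ind j)) * Xvar j)) \<in> AJ"
proof -
  let ?b = "const (Poly_Mapping.lookup f 0) + (\<Sum>j = 1..n. const (Poly_Mapping.lookup f (ind j)) * Xvar j)"
  have X: "Poly_Mapping.lookup (Xvar j) 0 = (0::'k)"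
    "Poly_Mapping.lookup (Xvar j) (ind i) = (if i = j then 1 else 0 :: 'k)" for i j
  proof -
    have "ind j \<noteq> 0" by (metis monom_degree_single monom_degree_zero nat.distinct(1))
    then show "Poly_Mapping.lookup (Xvar j) 0 = (0::'k)" by (simp add: Xvar_eq lookup_single when_def)
  qed (auto simp: Xvar_eq lookup_single when_def)
  have c: "Poly_Mapping.lookup (const c) (ind j) = (0::'k)" "Poly_Mapping.lookup (const c) 0 = c" for c :: 'k and j
  proof -
    have "ind j \<noteq> 0" by (metis monom_degree_single monom_degree_zero nat.distinct(1))
    then show "Poly_Mapping.lookup (const c) (ind j) = (0::'k)" by (simp add: const_def lookup_single when_def)
  qed (simp add: const_def)
  have "Poly_Mapping.lookup ?b 0 = Poly_Mapping.lookup f 0"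
    by (simp add: lookup_add lookup_sum lookup_const_mult X c)
  moreover have "Poly_Mapping.lookup ?b (ind i) = Poly_Mapping.lookup f (ind i)" if "i \<in> {1..n}" for i
    using that by (simp add: lookup_add lookup_sum lookup_const_mult X c if_distrib cong: if_cong)
  moreover have "?b \<in> carrier S" by (intro S_add S_sum S_mult) auto
  ultimately show ?thesis using f by (intro mem_AJ) (simp_all add: lookup_minus)
qed

lemma bicolon_sub_AJ:
  assumes f: "f \<in> carrier S"
    and fA: "\<And>m. m \<in> {l+1..n} \<Longrightarrow> f * (Avar * Xvar m) \<in> J"
    and fX: "\<And>i. i \<in> {1..l} \<Longrightarrow> f * Xvar i \<in> J"
  shows "f \<in> AJ"
proof -
  define c where "c j = Poly_Mapping.lookup f (ind j)" for j
  define b where "b = (\<Sum>j = 1..n. const (c j) * Xvar j)"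
  have n: "n \<in> {l+1..n}" using l_less by simp
  \<comment> \<open>\<open>lam n\<close> reads from A X_n f the coefficient of X_n in X_n f, which
    is the constant term of \<open>f\<close>.\<close>
  have "lam n (Avar * (Xvar n * f)) = 0"
    using lam_J[OF fA[OF n] n] by (simp add: mult_ac)
  then have "Poly_Mapping.lookup (Xvar n * f) (ind n + 0) = 0" by (simp add: lam_A_mult)
  then have f0: "Poly_Mapping.lookup f 0 = 0" by (simp only: Xvar_eq lookup_single_mult(1)) simp
  then have fb: "f - b \<in> AJ" using linear_part_mod_AJ[OF f] by (simp add: b_def c_def const_zero)
  then obtain h where h: "h \<in> carrier S" "f - b - Avar * h \<in> J" by (auto simp: AJ_def)
  have "(\<Sum>j = 1..n. \<Delta> i j * const (c j)) = 0" if i: "i \<in> {1..l}" for i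
  proof (rule V_eq_0)
    show "(\<Sum>j = 1..n. \<Delta> i j * const (c j)) \<in> V"
    proof (rule kvs.span_sum)
      fix j assume "j \<in> {1..n}"
      then show "\<Delta> i j * const (c j) \<in> V"
        using kvs.span_scale[OF \<Delta>_V[OF i], of j "c j"] by (simp add: kscale_def mult.commute)
    qed
    fix m assume m: "m \<in> {l+1..n}"
    \<comment> \<open>Modulo J, \<open>f\<close> is \<open>b\<close> plus A h; since A X_i and f X_i
      lie in J, so does X_i b.\<close>
    have "Xvar i * b = f * Xvar i - (Avar * Xvar i) * h - (f - b - Avar * h) * Xvar i"
      by (simp add: algebra_simps)
    also have "\<dots> \<in> J" using i l_le by (intro J_D(5,7) fX J_AX h i S_Xvar) auto
    finally have "lam m (Xvar i * b) = 0" using m by (rule lam_J)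
    moreover have "Xvar i * b = (\<Sum>j = 1..n. const (c j) * (Xvar i * Xvar j))"
      by (simp add: b_def sum_distrib_left mult_ac)
    ultimately have "(\<Sum>j = 1..n. c j * lam m (Xvar i * Xvar j)) = 0"
      by (simp add: lam_sum lam_const_mult)
    \<comment> \<open>Applying \<open>lam m\<close> turns each X_i X_j into the coefficient of X_m
      in Delta_ij, so the entries of Delta c vanish coordinate by coordinate.\<close>
    also have "(\<Sum>j = 1..n. c j * lam m (Xvar i * Xvar j)) = (\<Sum>j = 1..n. c j * Poly_Mapping.lookup (\<Delta> i j) (ind m))"
      by (intro sum.cong refl) (simp add: lam_XX[OF i])
    finally show "Poly_Mapping.lookup (\<Sum>j = 1..n. \<Delta> i j * const (c j)) (ind m) = 0"
      by (simp add: lookup_sum lookup_const_mult mult.commute[of _ "const _"])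
  qed
  then have "\<forall>j\<in>{1..n}. c j = 0" by (intro \<Delta>_ker) blast
  then have "b = 0" by (simp add: b_def const_zero)
  then show ?thesis using fb by simp
qed

end

section \<open>The ring $R$\<close>

text \<open>Take \<open>N\<close> with \<open>W N\<close> of least dimension. For a later index, a
  basis of \<open>W i\<close> extends to one of \<open>W N\<close> with no more elements, so the two
  bases coincide.\<close>

lemma (in vector_space) decreasing_chain_in_finite_span:
  assumes "finite B" and sub: "\<And>i. subspace (W i)" and dec: "\<And>i::nat. W (Suc i) \<subseteq> W i"
    and WB: "\<And>i. W i \<subseteq> span B"
  shows "\<exists>N. \<forall>i\<ge>N. W i = W N"
proof -
  obtain N where N: "\<And>i. dim (W N) \<le> dim (W i)"
    using ex_has_least_nat[of "\<lambda>_. True" 0 "\<lambda>i. dim (W i)"] by auto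
  have "W i = W N" if "i \<ge> N" for i
  proof
    show iN: "W i \<subseteq> W N" using dec that by (rule lift_Suc_antimono_le)
    obtain C where C: "C \<subseteq> W i" "independent C" "W i \<subseteq> span C" "card C = dim (W i)"
      by (rule basis_exists)
    obtain D where D: "C \<subseteq> D" "D \<subseteq> W N" "independent D" "W N \<subseteq> span D"
      using maximal_independent_subset_extend[of C "W N"] C iN by blast
    \<comment> \<open>Needed before cardinalities are compared, because \<open>card\<close> of an
      infinite set is 0.\<close>
    have "finite D" using independent_span_bound[OF \<open>finite B\<close> D(3)] D(2) WB by blast
    moreover have "card D \<le> card C" using N[of i] basis_card_eq_dim[OF D(2,4,3)] C(4) by simp
    ultimately have "D = C" using D(1) by (metis card_seteq)
    then show "W N \<subseteq> W i" using D(4) span_minimal[OF C(1) sub] by blast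
  qed
  then show ?thesis by blast
qed

context linear_matrix
begin

abbreviation "R \<equiv> R_ring n l \<Delta>"
abbreviation "res \<equiv> residue n l \<Delta>"
abbreviation "a \<equiv> a_elem n l \<Delta>"

lemma res_hom: "ring_hom_cring S R res"
  using ideal.rcos_ring_hom_cring[OF J_is_ideal S_cring]
  by (simp add: R_ring_def residue_def[abs_def])

lemma R_cring: "cring R"
  using res_hom by (rule ring_hom_cring.axioms(2))

lemma res_mult: "\<lbrakk>p \<in> carrier S; q \<in> carrier S\<rbrakk> \<Longrightarrow> res p \<otimes>\<^bsub>R\<^esub> res q = res (p * q)"
  using ring_hom_mult[OF ring_hom_cring.homh[OF res_hom], of p q] by simp

lemma res_add: "\<lbrakk>p \<in> carrier S; q \<in> carrier S\<rbrakk> \<Longrightarrow> res p \<oplus>\<^bsub>R\<^esub> res q = res (p + q)"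
  using ring_hom_add[OF ring_hom_cring.homh[OF res_hom], of p q] by simp

lemma res_eq_0: "p \<in> carrier S \<Longrightarrow> res p = \<zero>\<^bsub>R\<^esub> \<longleftrightarrow> p \<in> J"
  using ideal.rcos_const_imp_mem[OF J_is_ideal, of p] ring.a_rcos_zero[OF cring.axioms(1)[OF S_cring] J_is_ideal, of p]
  by (auto simp: R_ring_def FactRing_def residue_def)

lemma R_carrier: "carrier R = res ` carrier S"
  unfolding R_ring_def residue_def[abs_def] FactRing_def A_RCOSETS_def' by auto

lemma res_closed: "p \<in> carrier S \<Longrightarrow> res p \<in> carrier R"
  by (simp add: R_carrier)

lemma a_closed: "a \<in> carrier R"
  by (simp add: a_elem_def res_closed)

lemma res_AJ:
  assumes "f \<in> AJ"
  obtains h where "h \<in> carrier S" "res f = res h \<otimes>\<^bsub>R\<^esub> a"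
proof -
  obtain h where h: "f \<in> carrier S" "h \<in> carrier S" "f - Avar * h \<in> J"
    using assms by (auto simp: AJ_def)
  interpret R: cring R by (rule R_cring)
  have "res f = res (f - Avar * h) \<oplus>\<^bsub>R\<^esub> res (h * Avar)"
    using h by (subst res_add) (simp_all add: mult.commute)
  also have "\<dots> = res h \<otimes>\<^bsub>R\<^esub> a"
    using h res_eq_0[of "f - Avar * h"] by (simp add: a_elem_def res_mult res_closed)
  finally show thesis using that h(2) by blast
qed

lemma bicolon_a: "colon R {\<zero>\<^bsub>R\<^esub>} (colon R {\<zero>\<^bsub>R\<^esub>} {a}) = PIdl\<^bsub>R\<^esub> a" (is "?l = ?r")
proof
  interpret R: cring R by (rule R_cring)
  show "?r \<subseteq> ?l"
  proof
    fix x assume "x \<in> ?r"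
    then obtain y where y: "y \<in> carrier R" "x = y \<otimes>\<^bsub>R\<^esub> a" by (auto simp: cgenideal_def)
    have "x \<otimes>\<^bsub>R\<^esub> z = \<zero>\<^bsub>R\<^esub>" if "z \<in> carrier R" "z \<otimes>\<^bsub>R\<^esub> a = \<zero>\<^bsub>R\<^esub>" for z
    proof -
      have "x \<otimes>\<^bsub>R\<^esub> z = y \<otimes>\<^bsub>R\<^esub> (z \<otimes>\<^bsub>R\<^esub> a)" using y that(1) a_closed by (simp add: R.m_ac)
      then show ?thesis using y that(2) by simp
    qed
    then show "x \<in> ?l" using y a_closed by (auto simp: colon_def)
  qed
  show "?l \<subseteq> ?r"
  proof
    fix x assume x: "x \<in> ?l"
    then obtain f where f: "f \<in> carrier S" "x = res f" by (auto simp: colon_def R_carrier)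
    \<comment> \<open>The double colon condition read in S: \<open>f\<close> annihilates modulo J
      whatever A annihilates modulo J.\<close>
    have ann: "f * g \<in> J" if g: "g \<in> carrier S" "Avar * g \<in> J" for g
    proof -
      have "res g \<otimes>\<^bsub>R\<^esub> a = \<zero>\<^bsub>R\<^esub>"
        using g res_eq_0[of "g * Avar"] by (simp add: a_elem_def res_mult mult.commute)
      then have "res g \<in> colon R {\<zero>\<^bsub>R\<^esub>} {a}" using g res_closed by (simp add: colon_def)
      then have "res f \<otimes>\<^bsub>R\<^esub> res g = \<zero>\<^bsub>R\<^esub>" using x f(2) by (simp add: colon_def)
      then show ?thesis using f(1) g(1) res_eq_0[of "f * g"] by (simp add: res_mult)
    qed
    have "f \<in> AJ"
    proof (rule bicolon_sub_AJ[OF f(1)])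
      fix m assume m: "m \<in> {l+1..n}"
      then have "Avar * (Avar * Xvar m) \<in> J"
        using J_AAV[of "Xvar m"] kvs.span_base[of "Xvar m" gens2] by (simp add: mult.assoc)
      then show "f * (Avar * Xvar m) \<in> J" using m by (intro ann) simp_all
    next
      fix i assume i: "i \<in> {1..l}"
      then show "f * Xvar i \<in> J" using l_le by (intro ann J_AX) simp_all
    qed
    then obtain h where "h \<in> carrier S" "res f = res h \<otimes>\<^bsub>R\<^esub> a" by (rule res_AJ)
    then show "x \<in> ?r" using f(2) res_closed by (auto simp: cgenideal_def)
  qed
qed

text \<open>Each ideal of R/(a) is pulled back to S and cut down to the finite-dimensional span of
  1, X_1, ..., X_n. Every class has a representative there, so the ideal is recovered as the image
  of the subspace \<open>W i\<close>, and the chain stabilizes with these subspaces.\<close>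

lemma artinian_quotient: "artinian_ring (R Quot (PIdl\<^bsub>R\<^esub> a))"
  unfolding artinian_ring_def
proof (intro conjI allI impI)
  interpret R: cring R by (rule R_cring)
  let ?P = "PIdl\<^bsub>R\<^esub> a"
  define Q where "Q = R Quot ?P"
  have P: "ideal ?P R" by (rule R.cgenideal_ideal[OF a_closed])
  show "ring (R Quot ?P)" by (rule ideal.quotient_is_ring[OF P])
  define \<rho> where "\<rho> f = ?P +>\<^bsub>R\<^esub> res f" for f
  have hom: "ring_hom_ring R Q ((+>\<^bsub>R\<^esub>) ?P)" unfolding Q_def by (rule ideal.rcos_ring_hom_ring[OF P])
  interpret Q: ring Q unfolding Q_def by (rule ideal.quotient_is_ring[OF P])
  have \<rho>_closed: "\<rho> f \<in> carrier Q" if "f \<in> carrier S" for f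
    using ring_hom_closed[OF ring_hom_ring.homh[OF hom] res_closed[OF that]] by (simp add: \<rho>_def)
  have \<rho>_add: "\<rho> (f + g) = \<rho> f \<oplus>\<^bsub>Q\<^esub> \<rho> g" if "f \<in> carrier S" "g \<in> carrier S" for f g
    using ring_hom_add[OF ring_hom_ring.homh[OF hom] res_closed[OF that(1)] res_closed[OF that(2)]] that
    by (simp add: \<rho>_def res_add)
  have \<rho>_AJ: "\<rho> f = \<zero>\<^bsub>Q\<^esub>" if "f \<in> AJ" for f
  proof -
    obtain h where "h \<in> carrier S" "res f = res h \<otimes>\<^bsub>R\<^esub> a" by (rule res_AJ[OF \<open>f \<in> AJ\<close>])
    then have "res f \<in> ?P" using res_closed by (auto simp: cgenideal_def)
    then have "\<rho> f = ?P" unfolding \<rho>_def by (rule R.a_rcos_zero[OF P])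
    then show ?thesis by (simp add: Q_def FactRing_def)
  qed
  have Q_carrier: "carrier Q = \<rho> ` carrier S"
    unfolding \<rho>_def Q_def FactRing_def A_RCOSETS_def' by (auto simp: R_carrier)
  define B where "B = (insert 1 (Xvar ` {1..n}) :: 'k mpoly set)"
  have B: "finite B" "B \<subseteq> carrier S" by (auto simp: B_def)
  have S_sub: "kvs.subspace (carrier S)" by (rule kvs.subspaceI) simp_all
  then have BS: "kvs.span B \<subseteq> carrier S" using B(2) kvs.span_minimal by blast
  have lin: "\<exists>b \<in> kvs.span B. \<rho> f = \<rho> b" if f: "f \<in> carrier S" for f
  proof -
    let ?b = "const (Poly_Mapping.lookup f 0) + (\<Sum>j = 1..n. const (Poly_Mapping.lookup f (ind j)) * Xvar j)"
    have "const c \<in> kvs.span B" for c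
      using kvs.span_scale[OF kvs.span_base[of 1 B], of c] by (simp add: kscale_def B_def)
    moreover have "const c * Xvar j \<in> kvs.span B" if "j \<in> {1..n}" for c j
      using kvs.span_scale[OF kvs.span_base[of "Xvar j" B], of c] that by (simp add: kscale_def B_def)
    ultimately have b: "?b \<in> kvs.span B" by (intro kvs.span_add kvs.span_sum) blast+
    then have bS: "?b \<in> carrier S" using BS by blast
    have "\<rho> ((f - ?b) + ?b) = \<rho> (f - ?b) \<oplus>\<^bsub>Q\<^esub> \<rho> ?b" using f bS by (intro \<rho>_add S_diff)
    also have "\<dots> = \<rho> ?b" using \<rho>_AJ[OF linear_part_mod_AJ[OF f]] \<rho>_closed[OF bS] by simp
    finally show ?thesis using b by (intro bexI[of _ ?b]) (simp_all only: diff_add_cancel)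
  qed
  fix I :: "nat \<Rightarrow> 'k mpoly set set set"
  assume "(\<forall>i. ideal (I i) (R Quot ?P)) \<and> (\<forall>i. I (Suc i) \<subseteq> I i)"
  then have I: "\<And>i. ideal (I i) Q" and dec: "\<And>i. I (Suc i) \<subseteq> I i" by (auto simp: Q_def)
  define W where "W i = {f \<in> carrier S. \<rho> f \<in> I i} \<inter> kvs.span B" for i
  have IW: "I i = \<rho> ` W i" for i
  proof
    show "I i \<subseteq> \<rho> ` W i"
    proof
      fix x assume x: "x \<in> I i"
      then have "x \<in> carrier Q" by (rule ideal.Icarr[OF I])
      then obtain f where f: "f \<in> carrier S" "x = \<rho> f" by (auto simp: Q_carrier)
      obtain b where "b \<in> kvs.span B" "\<rho> f = \<rho> b" using lin[OF f(1)] by blast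
      then show "x \<in> \<rho> ` W i" using x f(2) BS by (auto simp: W_def)
    qed
  qed (auto simp: W_def)
  \<comment> \<open>The preimage along S -> R -> R/(a) is an ideal of S, hence closed under
    multiplication by constants.\<close>
  have "kvs.subspace (W i)" for i
  proof -
    have "ideal {r \<in> carrier R. ?P +>\<^bsub>R\<^esub> r \<in> I i} R" by (rule ring_hom_ring.ideal_vimage[OF hom I])
    moreover have "ring_hom_ring S R res"
      by (intro ring_hom_ringI2 cring.axioms(1) S_cring R_cring ring_hom_cring.homh[OF res_hom])
    ultimately have "ideal {f \<in> carrier S. res f \<in> {r \<in> carrier R. ?P +>\<^bsub>R\<^esub> r \<in> I i}} S"
      by (intro ring_hom_ring.ideal_vimage)
    also have "{f \<in> carrier S. res f \<in> {r \<in> carrier R. ?P +>\<^bsub>R\<^esub> r \<in> I i}} = {f \<in> carrier S. \<rho> f \<in> I i}"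
      using res_closed by (auto simp: \<rho>_def)
    finally show ?thesis
      unfolding W_def by (intro kvs.subspace_inter kvs.subspace_span S_ideal_subspace)
  qed
  then obtain N where "\<forall>i\<ge>N. W i = W N"
    using kvs.decreasing_chain_in_finite_span[OF B(1), of W] dec by (fastforce simp: W_def)
  then show "\<exists>N. \<forall>i\<ge>N. I i = I N" unfolding IW by metis
qed

lemma homogeneous_parameter_a: "homogeneous_parameter R (R_component n l \<Delta>) a"
proof -
  \<comment> \<open>A is indeterminate number 0, of degree 1 like the others, so the positive degree
    is 1.\<close>
  have "Avar \<in> S_component n 1"
    by (simp add: S_component_def) (simp add: Avar_def Xvar_eq)
  then have "a \<in> R_component n l \<Delta> 1" unfolding a_elem_def R_component_def by (rule imageI)
  then show ?thesis using artinian_quotient unfolding homogeneous_parameter_def by blast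
qed

end

theorem theorem5p4:
  fixes n l :: nat
    and \<Delta> :: "nat \<Rightarrow> nat \<Rightarrow> 'k::field mpoly"
  assumes "2 \<le> l" and "l + 2 \<le> n"
    and "\<forall>i \<in> {1..l}. \<forall>j \<in> {1..n}. \<Delta> i j \<in> carrier (S_ring n)"
    and "\<forall>i \<in> {1..l}. \<forall>j \<in> {1..l}. \<Delta> i j = \<Delta> j i"
    and "kvs.span (Xvar ` {l+1..n}) = kvs.span {\<Delta> i j | i j. i \<in> {1..l} \<and> j \<in> {1..n}}"
    and "\<forall>c :: nat \<Rightarrow> 'k. (\<forall>i \<in> {1..l}. (\<Sum>j = 1..n. \<Delta> i j * const (c j)) = 0)
           \<longrightarrow> (\<forall>j \<in> {1..n}. c j = 0)"
  shows "homogeneous_parameter (R_ring n l \<Delta>) (R_component n l \<Delta>) (a_elem n l \<Delta>)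
    \<and> colon (R_ring n l \<Delta>) {\<zero>\<^bsub>R_ring n l \<Delta>\<^esub>}
        (colon (R_ring n l \<Delta>) {\<zero>\<^bsub>R_ring n l \<Delta>\<^esub>} {a_elem n l \<Delta>})
      = PIdl\<^bsub>R_ring n l \<Delta>\<^esub> (a_elem n l \<Delta>)
    \<and> trivial_group (Ext1 (R_ring n l \<Delta>)
        (quotient_module (R_ring n l \<Delta>) (PIdl\<^bsub>R_ring n l \<Delta>\<^esub> (a_elem n l \<Delta>)))
        (regular_module (R_ring n l \<Delta>)))"
proof -
  interpret linear_matrix n l \<Delta>
    using assms by unfold_locales (simp_all only:, simp_all)
  show ?thesis
    using homogeneous_parameter_a bicolon_a cring.trivial_Ext1_quotient_principal[OF R_cring a_closed]
    by simp
qed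

end
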